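(* Let $\mathbf{\Phi}$ be an irreducible, positive recurrent and aperiodic discrete-time Markov chain on a countable state space $E$ with transition matrix $P$ and invariant probability vector $\boldsymbol\pi$. Let $A$ be a finite non-empty subset of $E$, $B=E\setminus A$, and let $\widetilde X=\begin{bmatrix}\widetilde X_A\\ \widetilde X_B\end{bmatrix}$ be the matrix given by $$\widetilde{X}_{A}=\left(I-P^{(A)}\right)^{\#}\left(\left[I,\; P_{AB}\widehat{P}_{BB}\right]-\left(\boldsymbol e+P_{AB}\widehat{P}_{BB}\boldsymbol e\right)\boldsymbol\pi^T\right),$$ $$\widetilde{X}_{B}=\widehat{P}_{BB}P_{BA}\widetilde{X}_A+\left[O,\;\widehat{P}_{BB}\right]-\widehat{P}_{BB}\boldsymbol e\,\boldsymbol \pi^T.$$ If $\mathbb{E}_{\boldsymbol\pi}[\tau_i]<\infty$ for some $i\in E$, then the deviation matrix $D=\sum_{n=0}^\infty\left(P^n-\boldsymbol e\boldsymbol\pi^T\right)$ satisfies $$D=(I-\boldsymbol{e}\boldsymbol{\pi}^{T})\widetilde{X}.$$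
   Context: $\mathbf{\Phi}=\{\Phi_k,k\ge 0\}$ is a discrete-time Markov chain on $E$ with transition matrix $P=(P(i,j))_{i,j\in E}$; $\boldsymbol\pi$ is its unique invariant probability vector ($\boldsymbol\pi^TP=\boldsymbol\pi^T$, $\boldsymbol\pi^T\boldsymbol e=1$). $\boldsymbol e$ is the column vector of ones, $I$ the identity matrix, $O$ the zero matrix, each of the size appropriate to the place where it occurs. $P_{A_1A_2}=(P(i,j))_{i\in A_1,j\in A_2}$ denotes blocks of $P$. For a matrix $X=(X(i,j))_{i,j\in E}$, $X_A$ and $X_B$ denote the rows of $X$ indexed by $A$ and by $B$ (with all columns in $E$); in a bracket $[\,\cdot\,,\,\cdot\,]$ the first block consists of the columns indexed by $A$ and the second of the columns indexed by $B$. $\widehat P_{BB}:=\sum_{k=0}^\infty P_{BB}^k$ (finite entrywise), and $P^{(A)}:=P_{AA}+P_{AB}\widehat P_{BB}P_{BA}$ is the transition matrix of the Markov chain censored on $A$. The group inverse $W^{\#}$ of a finite square matrix $W$ is the unique matrix with $WW^{\#}W=W$, $W^{\#}WW^{\#}=W^{\#}$, $W^{\#}W=WW^{\#}$. The series defining the deviation matrix $D$ is understood entrywise. $\tau_i:=\inf\{k\ge 1:\Phi_k=i\}$ is the first return time to $i$, and $\mathbb E_{\boldsymbol\pi}$ denotes expectation when $\Phi_0$ has distribution $\boldsymbol\pi$. *)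

theory Defs
  imports "HOL-Probability.Probability"
begin

section \<open>Matrices over the state space\<close>

text \<open>
  The state space \<open>E\<close> is the universe of a countable type \<open>'a\<close>. Vectors and matrices are
  real-valued functions; a block with rows in \<open>S\<close> and columns in \<open>T\<close> is a matrix of which only the
  entries in \<open>S \<times> T\<close> are used, so that the index set of the summation is an explicit
  argument of the products.
\<close>

type_synonym 'a vec = "'a \<Rightarrow> real"
type_synonym 'a mat = "'a \<Rightarrow> 'a \<Rightarrow> real"

definition ones :: "'a vec" where
  "ones = (\<lambda>_. 1)"

definition ident :: "'a mat" where
  "ident = (\<lambda>i j. of_bool (i = j))"

definition outer :: "'a vec \<Rightarrow> 'a vec \<Rightarrow> 'a mat" where
  "outer u v = (\<lambda>i j. u i * v j)"

definition mat_diff :: "'a mat \<Rightarrow> 'a mat \<Rightarrow> 'a mat" where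
  "mat_diff X Y = (\<lambda>i j. X i j - Y i j)"

definition mat_add :: "'a mat \<Rightarrow> 'a mat \<Rightarrow> 'a mat" where
  "mat_add X Y = (\<lambda>i j. X i j + Y i j)"

definition mat_mult :: "'a set \<Rightarrow> 'a mat \<Rightarrow> 'a mat \<Rightarrow> 'a mat" where
  "mat_mult S X Y = (\<lambda>i j. \<Sum>\<^sub>\<infinity>k\<in>S. X i k * Y k j)"

definition mat_vec :: "'a set \<Rightarrow> 'a mat \<Rightarrow> 'a vec \<Rightarrow> 'a vec" where
  "mat_vec S X v = (\<lambda>i. \<Sum>\<^sub>\<infinity>k\<in>S. X i k * v k)"

primrec mat_pow :: "'a set \<Rightarrow> 'a mat \<Rightarrow> nat \<Rightarrow> 'a mat" where
  "mat_pow S X 0 = ident"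
| "mat_pow S X (Suc n) = mat_mult S X (mat_pow S X n)"

definition col_blocks :: "'a set \<Rightarrow> 'a mat \<Rightarrow> 'a mat \<Rightarrow> 'a mat" where
  "col_blocks A X Y = (\<lambda>i j. if j \<in> A then X i j else Y i j)"

definition row_blocks :: "'a set \<Rightarrow> 'a mat \<Rightarrow> 'a mat \<Rightarrow> 'a mat" where
  "row_blocks A X Y = (\<lambda>i j. if i \<in> A then X i j else Y i j)"

definition is_group_inverse :: "'a set \<Rightarrow> 'a mat \<Rightarrow> 'a mat \<Rightarrow> bool" where
  "is_group_inverse A W V \<longleftrightarrow>
     (\<forall>i\<in>A. \<forall>j\<in>A. mat_mult A (mat_mult A W V) W i j = W i j) \<and>
     (\<forall>i\<in>A. \<forall>j\<in>A. mat_mult A (mat_mult A V W) V i j = V i j) \<and>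
     (\<forall>i\<in>A. \<forall>j\<in>A. mat_mult A V W i j = mat_mult A W V i j)"

text \<open>
  Requiring the entries outside \<open>A \<times> A\<close> to vanish makes the function representing the
  \<open>A \<times> A\<close> matrix unique.
\<close>

definition group_inverse :: "'a set \<Rightarrow> 'a mat \<Rightarrow> 'a mat" where
  "group_inverse A W =
     (THE V. is_group_inverse A W V \<and> (\<forall>i j. i \<notin> A \<or> j \<notin> A \<longrightarrow> V i j = 0))"

section \<open>Markov chains\<close>

definition prob_vector :: "'a vec \<Rightarrow> bool" where
  "prob_vector \<mu> \<longleftrightarrow> (\<forall>i. 0 \<le> \<mu> i) \<and> (\<mu> has_sum 1) UNIV"

definition stochastic :: "'a mat \<Rightarrow> bool" where
  "stochastic P \<longleftrightarrow> (\<forall>i. prob_vector (P i))"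

definition invariant_prob :: "'a mat \<Rightarrow> 'a vec \<Rightarrow> bool" where
  "invariant_prob P p \<longleftrightarrow>
     prob_vector p \<and> (\<forall>j. ((\<lambda>i. p i * P i j) has_sum p j) UNIV)"

text \<open>
  The law on path space (with its product \<open>\<sigma>\<close>-algebra) of the Markov chain with transition matrix
  \<open>P\<close> and initial distribution \<open>\<mu>\<close>, obtained from the Ionescu-Tulcea extension theorem; under
  \<open>chain_law P \<mu>\<close> the chain is the coordinate process. The lemma \<open>emeasure_chain_law_cylinder\<close> below
  confirms that the finite-dimensional distributions are the intended ones.
\<close>

definition step_law :: "'a mat \<Rightarrow> 'a vec \<Rightarrow> nat \<Rightarrow> (nat \<Rightarrow> 'a) \<Rightarrow> 'a measure" where
  "step_law P \<mu> n \<omega> =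
     density (count_space UNIV)
       (\<lambda>j. ennreal (case n of 0 \<Rightarrow> \<mu> j | Suc m \<Rightarrow> P (\<omega> m) j))"

definition chain_law :: "'a mat \<Rightarrow> 'a vec \<Rightarrow> (nat \<Rightarrow> 'a) measure" where
  "chain_law P \<mu> =
     projective_family.lim UNIV
       (Ionescu_Tulcea.CI (step_law P \<mu>) (\<lambda>_. count_space UNIV)) (\<lambda>_. count_space UNIV)"

definition return_time :: "'a \<Rightarrow> (nat \<Rightarrow> 'a) \<Rightarrow> ennreal" where
  "return_time i \<omega> = (INF k\<in>{k. 1 \<le> k \<and> \<omega> k = i}. of_nat k)"

definition expected_return_time :: "'a mat \<Rightarrow> 'a vec \<Rightarrow> 'a \<Rightarrow> ennreal" where
  "expected_return_time P \<mu> i = (\<integral>\<^sup>+\<omega>. return_time i \<omega> \<partial>chain_law P \<mu>)"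

definition irreducible_chain :: "'a mat \<Rightarrow> bool" where
  "irreducible_chain P \<longleftrightarrow> (\<forall>i j. \<exists>n. 0 < mat_pow UNIV P n i j)"

definition aperiodic_chain :: "'a mat \<Rightarrow> bool" where
  "aperiodic_chain P \<longleftrightarrow> (\<forall>i. Gcd {n::nat. 1 \<le> n \<and> 0 < mat_pow UNIV P n i i} = 1)"

text \<open>Row \<open>i\<close> of \<open>ident\<close> is the unit mass at \<open>i\<close>, i.e. the chain is started in \<open>i\<close>.\<close>

definition positive_recurrent_chain :: "'a mat \<Rightarrow> bool" where
  "positive_recurrent_chain P \<longleftrightarrow> (\<forall>i. expected_return_time P (ident i) i < \<infinity>)"

section \<open>Censoring and the deviation matrix\<close>

text \<open>In what follows \<open>B = E \<setminus> A\<close> is written \<open>- A\<close>.\<close>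

definition P_hat :: "'a mat \<Rightarrow> 'a set \<Rightarrow> 'a mat" where
  "P_hat P B = (\<lambda>i j. \<Sum>k. mat_pow B P k i j)"

definition censored :: "'a mat \<Rightarrow> 'a set \<Rightarrow> 'a mat" where
  "censored P A = mat_add P (mat_mult (- A) (mat_mult (- A) P (P_hat P (- A))) P)"

definition X_tilde_A :: "'a mat \<Rightarrow> 'a vec \<Rightarrow> 'a set \<Rightarrow> 'a mat" where
  "X_tilde_A P p A =
     (let R = mat_mult (- A) P (P_hat P (- A)) in
      mat_mult A (group_inverse A (mat_diff ident (censored P A)))
        (mat_diff (col_blocks A ident R)
          (outer (\<lambda>i. ones i + mat_vec (- A) R ones i) p)))"

definition X_tilde_B :: "'a mat \<Rightarrow> 'a vec \<Rightarrow> 'a set \<Rightarrow> 'a mat" where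
  "X_tilde_B P p A =
     (let H = P_hat P (- A) in
      mat_diff
        (mat_add (mat_mult A (mat_mult (- A) H P) (X_tilde_A P p A))
          (col_blocks A (\<lambda>_ _. 0) H))
        (outer (mat_vec (- A) H ones) p))"

definition X_tilde :: "'a mat \<Rightarrow> 'a vec \<Rightarrow> 'a set \<Rightarrow> 'a mat" where
  "X_tilde P p A = row_blocks A (X_tilde_A P p A) (X_tilde_B P p A)"

definition deviation_term :: "'a mat \<Rightarrow> 'a vec \<Rightarrow> nat \<Rightarrow> 'a mat" where
  "deviation_term P p n = mat_diff (mat_pow UNIV P n) (outer ones p)"

definition deviation :: "'a mat \<Rightarrow> 'a vec \<Rightarrow> 'a mat" where
  "deviation P p = (\<lambda>i j. \<Sum>n. deviation_term P p n i j)"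

section \<open>Finite-dimensional distributions of the chain\<close>

lemma emeasure_density_singleton:
  "emeasure (density (count_space UNIV) f) {x} = f x"
  by (simp add: emeasure_density)

lemma prob_space_prob_vector:
  assumes "prob_vector \<mu>"
  shows "prob_space (density (count_space UNIV) (\<lambda>j. ennreal (\<mu> j)))"
proof
  have nonneg: "0 \<le> \<mu> i" for i
    using assms by (simp add: prob_vector_def)
  have "\<mu> summable_on UNIV"
    using assms by (auto simp: prob_vector_def summable_on_def)
  then have abs: "Infinite_Set_Sum.abs_summable_on \<mu> UNIV"
    using summable_on_iff_abs_summable_on_real abs_summable_equivalent by blast
  have "(\<integral>\<^sup>+j. ennreal (\<mu> j) \<partial>count_space UNIV) = ennreal (infsum \<mu> UNIV)"
    by (simp add: nn_integral_conv_infsetsum[OF abs nonneg] infsetsum_infsum[OF abs])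
  also have "infsum \<mu> UNIV = 1"
    using assms by (auto simp: prob_vector_def intro: infsumI)
  finally show "emeasure (density (count_space UNIV) (\<lambda>j. ennreal (\<mu> j)))
      (space (density (count_space UNIV) (\<lambda>j. ennreal (\<mu> j)))) = 1"
    by (simp add: emeasure_density)
qed

lemma prob_space_step_law:
  assumes "stochastic P" "prob_vector \<mu>"
  shows "prob_space (step_law P \<mu> n \<omega>)"
  using assms unfolding step_law_def stochastic_def
  by (cases n) (auto intro!: prob_space_prob_vector)

lemma Ionescu_Tulcea_step_law:
  fixes P :: "'a::countable mat"
  assumes "stochastic P" "prob_vector \<mu>"
  shows "Ionescu_Tulcea (step_law P \<mu>) (\<lambda>_. count_space UNIV)"
proof (rule Ionescu_Tulcea.intro)
  fix n :: nat
  have sub: "step_law P \<mu> n \<omega> \<in> space (subprob_algebra (count_space UNIV))" for \<omega>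
    using prob_space_step_law[OF assms, of n \<omega>]
    by (auto simp: space_subprob_algebra step_law_def intro: prob_space_imp_subprob_space)
  show "step_law P \<mu> n \<in> PiM {0..<n} (\<lambda>_. count_space UNIV) \<rightarrow>\<^sub>M
          subprob_algebra (count_space UNIV)"
  proof (cases n)
    case 0
    have eq: "step_law P \<mu> n = (\<lambda>_. step_law P \<mu> n undefined)"
      by (auto simp: 0 step_law_def)
    show ?thesis
      by (subst eq) (rule measurable_const, rule sub)
  next
    case (Suc m)
    have eq: "step_law P \<mu> n = (\<lambda>x. step_law P \<mu> n (\<lambda>_. x)) \<circ> (\<lambda>\<omega>. \<omega> m)"
      by (auto simp: Suc step_law_def)
    have "(\<lambda>\<omega>. \<omega> m) \<in> PiM {0..<n} (\<lambda>_. count_space UNIV) \<rightarrow>\<^sub>M count_space (UNIV :: 'a set)"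
      by (rule measurable_component_singleton) (simp add: Suc)
    moreover have "(\<lambda>x. step_law P \<mu> n (\<lambda>_. x)) \<in>
        count_space UNIV \<rightarrow>\<^sub>M subprob_algebra (count_space UNIV)"
      using sub by (simp add: measurable_count_space_eq1)
    ultimately show ?thesis
      by (subst eq) (rule measurable_comp)
  qed
qed (rule prob_space_step_law[OF assms])

lemma sets_chain_law:
  fixes P :: "'a::countable mat"
  assumes "stochastic P" "prob_vector \<mu>"
  shows "sets (chain_law P \<mu>) = sets (PiM UNIV (\<lambda>_. count_space UNIV))"
proof -
  interpret Ionescu_Tulcea "step_law P \<mu>" "\<lambda>_. count_space UNIV"
    by (rule Ionescu_Tulcea_step_law[OF assms])
  show ?thesis unfolding chain_law_def by (rule PF.sets_lim)
qed

lemma emeasure_chain_law_cylinder: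
  fixes P :: "'a::countable mat"
  assumes "stochastic P" "prob_vector \<mu>"
  shows "emeasure (chain_law P \<mu>) {\<omega>. \<forall>k\<le>n. \<omega> k = x k} =
           ennreal (\<mu> (x 0) * (\<Prod>k<n. P (x k) (x (Suc k))))"
proof -
  let ?M = "\<lambda>_::nat. count_space (UNIV :: 'a set)"
  interpret Ionescu_Tulcea "step_law P \<mu>" ?M
    by (rule Ionescu_Tulcea_step_law[OF assms])
  have sing: "{restrict x {0..<m}} \<in> sets (PiM {0..<m} ?M)" for m
  proof -
    have "{restrict x {0..<m}} = PiE {0..<m} (\<lambda>k. {x k})"
      by (auto simp: PiE_iff extensional_def restrict_def fun_eq_iff)
    then show ?thesis by (auto intro!: sets_PiM_I_finite)
  qed
  have C0: "C 0 m (\<lambda>_. undefined) {restrict x {0..<m}} =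
      (\<Prod>k<m. ennreal (case k of 0 \<Rightarrow> \<mu> (x k) | Suc l \<Rightarrow> P (x l) (x k)))" (is "_ = ?R m") for m
  proof (induction m)
    case 0
    have "{restrict x {0..<0}} = {\<lambda>_. undefined}" by auto
    then show ?case using sing[of 0] by simp
  next
    case (Suc m)
    let ?C = "C 0 m (\<lambda>_. undefined)" and ?r = "restrict x {0..<m}"
    have und: "(\<lambda>_. undefined) \<in> space (PiM {0..<0} ?M)" by (simp add: space_PiM)
    have mC: "measurable ?C N = measurable (PiM {0..<m} ?M) N" for N :: "(nat \<Rightarrow> 'a) measure measure"
      by (rule measurable_cong_sets) (use sets_C[OF und, of m] in auto)
    have spC: "space ?C = space (PiM {0..<m} ?M)"
      using space_C[OF und, of m] by simp
    have "C 0 (Suc m) (\<lambda>_. undefined) {restrict x {0..<Suc m}} =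
        (\<integral>\<^sup>+\<omega>. eP m \<omega> {restrict x {0..<Suc m}} \<partial>?C)"
      unfolding C.simps add_0
      by (rule emeasure_bind[OF _ _ sing]) (auto simp: spC mC space_PiM PiE_eq_empty_iff)
    also have "\<dots> = (\<integral>\<^sup>+\<omega>. step_law P \<mu> m ?r {x m} * indicator {?r} \<omega> \<partial>?C)"
    proof (rule nn_integral_cong)
      fix \<omega> assume "\<omega> \<in> space ?C"
      then have \<omega>: "\<omega> \<in> space (PiM {0..<m} ?M)" by (simp add: spC)
      have "(\<lambda>y. fun_upd \<omega> m y) -` {restrict x {0..<Suc m}} \<inter> space (?M m) =
          (if \<omega> = ?r then {x m} else {})"
      proof -
        have "fun_upd \<omega> m y = restrict x {0..<Suc m} \<longleftrightarrow> \<omega> = ?r \<and> y = x m" for y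
        proof
          assume *: "fun_upd \<omega> m y = restrict x {0..<Suc m}"
          have "\<omega> k = ?r k" for k
            using fun_cong[OF *, of k] \<omega>
            by (cases "k < m"; cases "k = m") (auto simp: space_PiM PiE_iff extensional_def)
          with fun_cong[OF *, of m] show "\<omega> = ?r \<and> y = x m"
            by auto
        qed (auto simp: fun_eq_iff)
        then show ?thesis by auto
      qed
      then show "eP m \<omega> {restrict x {0..<Suc m}} =
          step_law P \<mu> m ?r {x m} * indicator {?r} \<omega>"
        by (subst emeasure_eP[OF \<omega> sing]) (auto simp: indicator_def)
    qed
    also have "\<dots> = step_law P \<mu> m ?r {x m} * ?R m"
      using sing[of m] sets_C[OF und, of m] by (subst nn_integral_cmult_indicator) (auto simp: Suc)
    also have "step_law P \<mu> m ?r {x m} =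
        ennreal (case m of 0 \<Rightarrow> \<mu> (x m) | Suc l \<Rightarrow> P (x l) (x m))"
      unfolding step_law_def by (subst emeasure_density_singleton) (auto split: nat.split)
    finally show ?case by (simp add: mult.commute)
  qed
  have "{\<omega>. \<forall>k\<le>n. \<omega> k = x k} = PF.emb UNIV {0..<Suc n} {restrict x {0..<Suc n}}"
    by (auto simp: prod_emb_def space_PiM less_Suc_eq_le restrict_def fun_eq_iff)
      (metis (full_types))
  then have "emeasure (chain_law P \<mu>) {\<omega>. \<forall>k\<le>n. \<omega> k = x k} =
      C 0 (Suc n) (\<lambda>_. undefined) (PF.emb {0..<Suc n} {0..<Suc n} {restrict x {0..<Suc n}})"
    unfolding chain_law_def by (simp add: lim[OF _ sing] emeasure_CI[OF order_refl sing] del: C.simps)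
  also have "PF.emb {0..<Suc n} {0..<Suc n} {restrict x {0..<Suc n}} = {restrict x {0..<Suc n}}"
    by (rule prod_emb_id) (auto simp: space_PiM)
  also have "C 0 (Suc n) (\<lambda>_. undefined) {restrict x {0..<Suc n}} =
      ennreal (\<mu> (x 0)) * (\<Prod>k<n. ennreal (P (x k) (x (Suc k))))"
    unfolding C0 by (subst prod.lessThan_Suc_shift) simp
  also have "\<dots> = ennreal (\<mu> (x 0) * (\<Prod>k<n. P (x k) (x (Suc k))))"
    using assms by (subst prod_ennreal)
      (auto simp: stochastic_def prob_vector_def ennreal_mult prod_nonneg)
  finally show ?thesis .
qed

end

theory Submission
  imports Defs
begin

text \<open>
  Fix a column \<open>j\<close> and write \<open>y\<close> for that column of
  \<open>X_tilde P p A\<close>. The formula says \<open>D(i, j) = y i - p y\<close>, where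
  \<open>p y\<close> is the \<open>p\<close>-mean of \<open>y\<close>. It holds because
  \<open>y\<close> solves the Poisson equation \<open>y = c + P y\<close> with
  \<open>c x = of_bool (x = j) - p j\<close>. Iterating the equation gives
  \<open>(\<Sum>n<N. P\<^sup>n(i, j) - p j) = y i - (P\<^sup>N y) i\<close>, and
  \<open>P\<^sup>N y\<close> tends to the constant \<open>p y\<close>: the entries
  \<open>P\<^sup>N(i, k)\<close> converge to \<open>p k\<close>, and since
  \<open>p i * P\<^sup>N(i, k) \<le> p k\<close> the convergence is dominated as soon as
  \<open>y\<close> is \<open>p\<close>-integrable (\<open>poisson_solution_sums\<close>). So
  summability of the series and the value of the sum come out together. Three things have to be
  supplied.

  \<^item> Integrability of \<open>y\<close>. It reduces to that of the expected hitting time of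
  \<open>A\<close>. The hypothesis bounds the mean hitting time of some single state \<open>i\<close>,
  and the hitting time of \<open>A\<close> exceeds that of \<open>i\<close> by at most a constant
  (\<open>hitting_time_le\<close>, \<open>expected_hitting_time_finite\<close>).

  \<^item> Convergence \<open>P\<^sup>N(i, k) \<longlongrightarrow> p k\<close>
  (\<open>mat_pow_tendsto\<close>), by coupling: two independent copies of the chain form a chain with
  invariant vector \<open>p \<otimes> p\<close>, which is irreducible because \<open>P\<close> is
  irreducible and aperiodic. An irreducible chain with an invariant probability vector almost surely
  hits every nonempty set (\<open>survival_tendsto_zero\<close>), here the diagonal, and before that
  time is the only difference between the two starting points.

  \<^item> The Poisson equation for the given matrix (\<open>X_tilde_poisson\<close>). Let
  \<open>H(x, j)\<close>, \<open>w x\<close> and \<open>F(x, a)\<close> be the expected number of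
  visits to \<open>j\<close> from time 0 until strictly before the first return to \<open>A\<close>,
  the expected time of that return and the distribution of the state at that time. All three are
  values of one operator, the potential of the chain killed on \<open>A\<close>; its first-step
  equation holds for starting states inside and outside \<open>A\<close> alike, and averaging it over \<open>p\<close>
  gives a Kac identity (\<open>kac\<close>). The blocks of the formula are \<open>[I, P_{AB} H] = H\<close> and
  \<open>e + P_{AB} H e = w\<close> on \<open>A\<close>, and the censored matrix is \<open>F\<close>
  on \<open>A \<times> A\<close>. Hence both blocks of rows combine into \<open>y = F u + q\<close>
  with \<open>u = y\<close> on \<open>A\<close> and \<open>q x = H(x, j) - w x * p j\<close>, and
  first-step analysis turns this into the Poisson equation. For rows in \<open>A\<close> one needs
  that the group inverse \<open>V\<close> of \<open>W = I - F\<close> satisfies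
  \<open>W V = I - e \<nu>\<close>, \<open>\<nu>\<close> being \<open>p\<close> normalised on
  \<open>A\<close>, and that \<open>\<nu> q = 0\<close>; the latter is the Kac identity. The kernel of
  \<open>W\<close> consists of constants, as \<open>u = F u\<close> on \<open>A\<close> makes
  \<open>F u\<close> an integrable harmonic function, and such functions are constant by the case
  \<open>c = 0\<close> of the iteration above.
\<close>

section \<open>Sums as integrals over the counting measure\<close>

text \<open>
  Nonnegative sums are handled as integrals with values in \<open>ennreal\<close>, where interchanging sums is
  unconditional; this lemma returns to real infinite sums once finiteness is known.
\<close>
lemma infsum_nn_integral:
  fixes f :: "'a \<Rightarrow> real"
  assumes nonneg: "\<And>k. k \<in> S \<Longrightarrow> 0 \<le> f k"
    and fin: "(\<integral>\<^sup>+k. ennreal (f k) * indicator S k \<partial>count_space UNIV) < \<infinity>"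
  shows "f summable_on S"
    and "ennreal (infsum f S) = (\<integral>\<^sup>+k. ennreal (f k) * indicator S k \<partial>count_space UNIV)"
proof -
  have eq: "(\<integral>\<^sup>+k. ennreal (f k) \<partial>count_space S) =
      (\<integral>\<^sup>+k. ennreal (f k) * indicator S k \<partial>count_space UNIV)"
    by (rule nn_integral_count_space_indicator) simp
  have "integrable (count_space S) f"
  proof (rule integrableI_nonneg)
    show "AE x in count_space S. 0 \<le> f x" by (simp add: AE_count_space nonneg)
  qed (use fin eq in auto)
  then have abs: "Infinite_Set_Sum.abs_summable_on f S"
    by (simp add: Infinite_Set_Sum.abs_summable_on_def)
  then show "f summable_on S"
    using abs_summable_equivalent summable_on_iff_abs_summable_on_real by blast
  show "ennreal (infsum f S) = (\<integral>\<^sup>+k. ennreal (f k) * indicator S k \<partial>count_space UNIV)"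
    using nn_integral_conv_infsetsum[OF abs nonneg] eq infsetsum_infsum[OF abs] by simp
qed

lemma nn_integral_has_sum:
  fixes f :: "'a \<Rightarrow> real"
  assumes "(f has_sum s) UNIV" and nonneg: "\<And>k. 0 \<le> f k"
  shows "(\<integral>\<^sup>+k. ennreal (f k) \<partial>count_space UNIV) = ennreal s"
proof -
  have "f summable_on UNIV" using assms(1) by (auto simp: summable_on_def)
  then have abs: "Infinite_Set_Sum.abs_summable_on f UNIV"
    using summable_on_iff_abs_summable_on_real abs_summable_equivalent by blast
  show ?thesis
    using nn_integral_conv_infsetsum[OF abs nonneg] infsetsum_infsum[OF abs] infsumI[OF assms(1)]
    by simp
qed

lemma integrable_has_sum:
  fixes f :: "'a \<Rightarrow> real"
  assumes "integrable (count_space UNIV) f"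
  shows "(f has_sum (\<integral>x. f x \<partial>count_space UNIV)) UNIV"
proof -
  have abs: "Infinite_Set_Sum.abs_summable_on f UNIV"
    using assms by (simp add: Infinite_Set_Sum.abs_summable_on_def)
  then have "f summable_on UNIV"
    using abs_summable_equivalent summable_on_iff_abs_summable_on_real by blast
  moreover have "infsum f UNIV = (\<integral>x. f x \<partial>count_space UNIV)"
    using infsetsum_infsum[OF abs] by (simp add: infsetsum_def)
  ultimately show ?thesis by (metis has_sum_infsum)
qed

lemma has_sum_nn_integral:
  fixes f :: "'a \<Rightarrow> real"
  assumes nonneg: "\<And>k. 0 \<le> f k" "0 \<le> s"
    and "(\<integral>\<^sup>+k. ennreal (f k) \<partial>count_space UNIV) = ennreal s"
  shows "(f has_sum s) UNIV"
proof -
  have eq: "(\<integral>\<^sup>+k. ennreal (f k) * indicator UNIV k \<partial>count_space UNIV) = ennreal s"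
    using assms(3) by simp
  then have fin: "(\<integral>\<^sup>+k. ennreal (f k) * indicator UNIV k \<partial>count_space UNIV) < \<infinity>" by simp
  have "f summable_on UNIV" "ennreal (infsum f UNIV) = ennreal s"
    using infsum_nn_integral[OF nonneg(1) fin] eq by simp_all
  then show ?thesis
    using nonneg by (metis ennreal_inj has_sum_infsum infsum_nonneg)
qed

lemma nn_integral_indicator_point:
  "(\<integral>\<^sup>+k. f k * indicator {y} k \<partial>count_space UNIV) = f y"
proof -
  have "(\<integral>\<^sup>+k. f k * indicator {y} k \<partial>count_space UNIV) = (\<integral>\<^sup>+k. f y * indicator {y} k \<partial>count_space UNIV)"
    by (intro nn_integral_cong) (auto simp: indicator_def)
  then show ?thesis by (simp add: nn_integral_cmult_indicator)
qed

lemma nn_integral_product: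
  "(\<integral>\<^sup>+z. (case z of (k, l) \<Rightarrow> f k * g l) \<partial>count_space UNIV) =
    (\<integral>\<^sup>+k. f k \<partial>count_space UNIV) * (\<integral>\<^sup>+l. g l \<partial>count_space UNIV)"
  by (simp add: nn_integral_fst_count_space[symmetric] nn_integral_cmult nn_integral_multc)

lemma tendsto_zero_of_finite_suminf:
  fixes a :: "nat \<Rightarrow> ennreal"
  assumes "(\<Sum>n. a n) < \<infinity>"
  shows "a \<longlonglongrightarrow> 0"
proof -
  have fin: "a n < \<infinity>" for n
    using assms ennreal_suminf_lessD[of a \<infinity> n] by simp
  then have a: "a n = ennreal (enn2real (a n))" for n
    by (simp add: less_top)
  have "summable (\<lambda>n. enn2real (a n))"
    by (rule summable_suminf_not_top) (use assms a in auto)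
  then have "(\<lambda>n. ennreal (enn2real (a n))) \<longlonglongrightarrow> ennreal 0"
    by (intro tendsto_ennrealI summable_LIMSEQ_zero)
  then show ?thesis using a by simp
qed

section \<open>Taboo operators and their potentials\<close>

text \<open>
  The \<open>n\<close>-th iterate applied to \<open>f\<close> is \<open>E\<^sub>x[f(\<Phi>\<^sub>n); \<Phi>\<^sub>1, \<dots>, \<Phi>\<^sub>n \<notin> A]\<close>. The taboo starts at time 1, so
  that \<open>x\<close> itself may lie in \<open>A\<close>; for \<open>A = {}\<close> the operator is \<open>P\<close>.
\<close>
definition taboo_step :: "'a mat \<Rightarrow> 'a set \<Rightarrow> ('a \<Rightarrow> ennreal) \<Rightarrow> 'a \<Rightarrow> ennreal" where
  "taboo_step P A f x = (\<integral>\<^sup>+k. ennreal (P x k) * (f k * indicator (- A) k) \<partial>count_space UNIV)"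

text \<open>
  The Green operator of the chain killed on \<open>A\<close>: the expected sum of \<open>f\<close> along the chain from time
  0 up to, but not including, its first return to \<open>A\<close>. For \<open>f = 1\<close> it is the expected
  return time, for \<open>f = indicator {j}\<close> the expected number of visits to \<open>j\<close>.
\<close>
definition potential :: "'a mat \<Rightarrow> 'a set \<Rightarrow> ('a \<Rightarrow> ennreal) \<Rightarrow> 'a \<Rightarrow> ennreal" where
  "potential P A f x = (\<Sum>n. (taboo_step P A ^^ n) f x)"

definition mean :: "'a vec \<Rightarrow> ('a \<Rightarrow> ennreal) \<Rightarrow> ennreal" where
  "mean p f = (\<integral>\<^sup>+x. ennreal (p x) * f x \<partial>count_space UNIV)"

lemma taboo_step_mono:
  assumes "\<And>k. k \<notin> A \<Longrightarrow> f k \<le> g k"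
  shows "taboo_step P A f x \<le> taboo_step P A g x"
  unfolding taboo_step_def
  by (intro nn_integral_mono mult_left_mono) (auto simp: indicator_def assms)

lemma taboo_step_cong:
  assumes "\<And>k. k \<notin> A \<Longrightarrow> f k = g k"
  shows "taboo_step P A f x = taboo_step P A g x"
  by (intro antisym taboo_step_mono) (simp_all add: assms)

lemma taboo_step_antimono_taboo: "A \<subseteq> B \<Longrightarrow> taboo_step P B f x \<le> taboo_step P A f x"
  unfolding taboo_step_def
  by (intro nn_integral_mono mult_left_mono) (auto simp: indicator_def)

lemma taboo_step_add:
  "taboo_step P A (\<lambda>k. f k + g k) x = taboo_step P A f x + taboo_step P A g x"
  unfolding taboo_step_def
  by (subst nn_integral_add[symmetric]) (auto simp: algebra_simps distrib_left distrib_right)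

lemma taboo_step_cmult: "taboo_step P A (\<lambda>k. c * f k) x = c * taboo_step P A f x"
  unfolding taboo_step_def
  by (subst nn_integral_cmult[symmetric]) (auto simp: ac_simps)

lemma taboo_step_suminf:
  "taboo_step P A (\<lambda>k. \<Sum>n. f n k) x = (\<Sum>n. taboo_step P A (f n) x)"
  unfolding taboo_step_def
  by (subst nn_integral_suminf[symmetric]) (auto simp: ennreal_suminf_multc ennreal_suminf_cmult)

lemma taboo_step_nn_integral:
  "taboo_step P A (\<lambda>k. \<integral>\<^sup>+z. f z k \<partial>count_space UNIV) x =
     (\<integral>\<^sup>+z. taboo_step P A (f z) x \<partial>count_space UNIV)"
proof -
  let ?F = "\<lambda>(k, z). ennreal (P x k) * (f z k * indicator (- A) k)"
  have "taboo_step P A (\<lambda>k. \<integral>\<^sup>+z. f z k \<partial>count_space UNIV) x =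
      (\<integral>\<^sup>+k. \<integral>\<^sup>+z. ?F (k, z) \<partial>count_space UNIV \<partial>count_space UNIV)"
    unfolding taboo_step_def by (simp add: nn_integral_cmult nn_integral_multc)
  also have "\<dots> = (\<integral>\<^sup>+z. \<integral>\<^sup>+k. ?F (k, z) \<partial>count_space UNIV \<partial>count_space UNIV)"
    by (simp only: nn_integral_fst_count_space nn_integral_snd_count_space)
  finally show ?thesis unfolding taboo_step_def by simp
qed

lemma taboo_power_mono:
  assumes "\<And>k. f k \<le> g k"
  shows "(taboo_step P A ^^ n) f x \<le> (taboo_step P A ^^ n) g x"
proof (induction n arbitrary: x)
  case (Suc n)
  then show ?case by (auto intro: taboo_step_mono)
qed (simp add: assms)

lemma taboo_power_add:
  "(taboo_step P A ^^ n) (\<lambda>k. f k + g k) x = (taboo_step P A ^^ n) f x + (taboo_step P A ^^ n) g x"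
proof (induction n arbitrary: x)
  case (Suc n)
  then have "(taboo_step P A ^^ n) (\<lambda>k. f k + g k) =
      (\<lambda>x. (taboo_step P A ^^ n) f x + (taboo_step P A ^^ n) g x)" by auto
  then show ?case by (simp add: taboo_step_add)
qed simp

lemma taboo_power_cmult:
  "(taboo_step P A ^^ n) (\<lambda>k. c * f k) x = c * (taboo_step P A ^^ n) f x"
proof (induction n arbitrary: x)
  case (Suc n)
  then have "(taboo_step P A ^^ n) (\<lambda>k. c * f k) = (\<lambda>x. c * (taboo_step P A ^^ n) f x)" by auto
  then show ?case by (simp add: taboo_step_cmult)
qed simp

lemma taboo_power_nn_integral:
  "(taboo_step P A ^^ n) (\<lambda>k. \<integral>\<^sup>+z. f z k \<partial>count_space UNIV) x =
     (\<integral>\<^sup>+z. (taboo_step P A ^^ n) (f z) x \<partial>count_space UNIV)"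
proof (induction n arbitrary: x)
  case (Suc n)
  then have "(taboo_step P A ^^ n) (\<lambda>k. \<integral>\<^sup>+z. f z k \<partial>count_space UNIV) =
     (\<lambda>x. \<integral>\<^sup>+z. (taboo_step P A ^^ n) (f z) x \<partial>count_space UNIV)" by auto
  then show ?case by (simp add: taboo_step_nn_integral)
qed simp

text \<open>
  Every \<open>f\<close> is the superposition of the functions \<open>f z * indicator {z}\<close>, and iterates commute with
  superpositions.
\<close>
lemma taboo_power_kernel:
  "(taboo_step P A ^^ n) f x =
     (\<integral>\<^sup>+z. (taboo_step P A ^^ n) (indicator {z}) x * f z \<partial>count_space UNIV)"
proof -
  have f: "f = (\<lambda>k. \<integral>\<^sup>+z. f z * indicator {z} k \<partial>count_space UNIV)"
    (is "_ = ?g")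
  proof
    fix k
    have "?g k = (\<integral>\<^sup>+z. f z * indicator {k} z \<partial>count_space UNIV)"
      by (intro nn_integral_cong) (auto simp: indicator_def)
    then show "f k = ?g k" by (simp add: nn_integral_indicator_point)
  qed
  show ?thesis
    by (subst f) (simp add: taboo_power_nn_integral taboo_power_cmult mult.commute)
qed

lemma potential_unfold: "potential P A f x = f x + taboo_step P A (potential P A f) x"
proof -
  have "potential P A f x = f x + (\<Sum>n. (taboo_step P A ^^ Suc n) f x)"
    unfolding potential_def by (subst suminf_offset[of _ 1]) auto
  also have "(\<Sum>n. (taboo_step P A ^^ Suc n) f x) = taboo_step P A (potential P A f) x"
    unfolding potential_def[abs_def] by (simp add: taboo_step_suminf)
  finally show ?thesis .
qed

text \<open>
  Splitting off time 0, as in \<open>potential_unfold\<close>, but shifting the path at its far end.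
\<close>
lemma potential_unfold': "potential P A f x = f x + potential P A (taboo_step P A f) x"
proof -
  have "potential P A f x = f x + (\<Sum>n. (taboo_step P A ^^ Suc n) f x)"
    unfolding potential_def by (subst suminf_offset[of _ 1]) auto
  then show ?thesis
    unfolding potential_def funpow_Suc_right by simp
qed

lemma potential_mono: "(\<And>k. f k \<le> g k) \<Longrightarrow> potential P A f x \<le> potential P A g x"
  unfolding potential_def by (intro suminf_le taboo_power_mono) auto

lemma potential_add:
  "potential P A (\<lambda>k. f k + g k) x = potential P A f x + potential P A g x"
  unfolding potential_def by (simp add: taboo_power_add suminf_add)

lemma potential_sum:
  "finite S \<Longrightarrow> potential P A (\<lambda>k. \<Sum>a\<in>S. f a k) x = (\<Sum>a\<in>S. potential P A (f a) x)"
proof (induction S rule: finite_induct)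
  case empty
  have "(taboo_step P A ^^ n) (\<lambda>_. 0) x = 0" for n
    using taboo_power_cmult[of n P A 0 "\<lambda>_. 0" x] by simp
  then show ?case by (simp add: potential_def)
qed (simp add: potential_add)

lemma potential_kernel:
  "potential P A f x = (\<integral>\<^sup>+z. potential P A (indicator {z}) x * f z \<partial>count_space UNIV)"
  unfolding potential_def
  by (subst taboo_power_kernel, subst nn_integral_suminf[symmetric])
     (auto simp: ennreal_suminf_multc)

text \<open>
  Only time 0 can contribute, since the chain is killed when it enters \<open>A\<close>.
\<close>
lemma potential_taboo_supported:
  assumes "\<And>k. k \<notin> A \<Longrightarrow> f k = 0"
  shows "potential P A f x = f x"
proof -
  have 0: "taboo_step P A f = (\<lambda>_. 0)"
    using taboo_step_cong[of A f "\<lambda>_. 0" P] assms by (auto simp: taboo_step_def)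
  have "potential P A (\<lambda>_. 0) x = 0"
    using potential_sum[of "{}" P A "\<lambda>_ _. 0" x] by simp
  then show ?thesis by (subst potential_unfold') (simp add: 0)
qed

lemma partial_potential_Suc:
  "(\<Sum>k<Suc n. (taboo_step P A ^^ k) f x) =
     f x + taboo_step P A (\<lambda>y. \<Sum>k<n. (taboo_step P A ^^ k) f y) x"
proof -
  have sum: "taboo_step P A (\<lambda>y. \<Sum>k\<in>S. g k y) x = (\<Sum>k\<in>S. taboo_step P A (g k) x)"
    if "finite S" for S :: "nat set" and g
    using that
  proof (induction S rule: finite_induct)
    case empty
    show ?case by (simp add: taboo_step_def)
  qed (simp add: taboo_step_add)
  show ?thesis
    by (subst sum) (simp_all add: sum.lessThan_Suc_shift del: sum.lessThan_Suc)
qed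

lemma mean_mono: "(\<And>x. f x \<le> g x) \<Longrightarrow> mean p f \<le> mean p g"
  unfolding mean_def by (intro nn_integral_mono mult_left_mono) auto

lemma mean_add: "mean p (\<lambda>x. f x + g x) = mean p f + mean p g"
  unfolding mean_def by (simp add: distrib_left nn_integral_add)

lemma mean_suminf: "mean p (\<lambda>x. \<Sum>n. f n x) = (\<Sum>n. mean p (f n))"
  unfolding mean_def by (subst nn_integral_suminf[symmetric]) (auto simp: ennreal_suminf_cmult)

lemma mean_indicator: "mean p (indicator {y}) = ennreal (p y)"
  unfolding mean_def by (rule nn_integral_indicator_point)

lemma stochastic_nonneg: "stochastic P \<Longrightarrow> 0 \<le> P x y"
  by (simp add: stochastic_def prob_vector_def)

lemma nn_integral_stochastic_row:
  assumes "stochastic P"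
  shows "(\<integral>\<^sup>+k. ennreal (P x k) \<partial>count_space UNIV) = 1"
proof -
  have "(P x has_sum 1) UNIV" using assms by (simp add: stochastic_def prob_vector_def)
  then show ?thesis by (subst nn_integral_has_sum) (auto simp: stochastic_nonneg assms)
qed

lemma taboo_step_le_const:
  assumes "stochastic P" "\<And>k. k \<notin> A \<Longrightarrow> f k \<le> c"
  shows "taboo_step P A f x \<le> c"
proof -
  have "taboo_step P A f x \<le> (\<integral>\<^sup>+k. ennreal (P x k) * c \<partial>count_space UNIV)"
    unfolding taboo_step_def
    by (intro nn_integral_mono mult_left_mono) (auto simp: indicator_def assms(2))
  also have "\<dots> = c" by (simp add: nn_integral_multc nn_integral_stochastic_row[OF assms(1)])
  finally show ?thesis .
qed

lemma taboo_step_one: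
  assumes "stochastic P"
  shows "taboo_step P {} (\<lambda>_. c) x = c"
  using assms by (simp add: taboo_step_def nn_integral_multc nn_integral_stochastic_row)

lemma taboo_power_le_const:
  assumes "stochastic P" "\<And>k. f k \<le> c"
  shows "(taboo_step P A ^^ n) f x \<le> c"
  by (induction n arbitrary: x) (auto intro: taboo_step_le_const assms)

text \<open>
  This identifies the powers of the block \<open>P_{BB}\<close>, with \<open>B\<close> the complement of \<open>A\<close>. For rows outside
  \<open>B\<close> the recursion of \<open>mat_pow\<close> yields \<open>P_{AB} P_{BB}^{n-1}\<close> for \<open>n \<ge> 1\<close>, which is again what the taboo
  operator computes.
\<close>
lemma mat_pow_taboo:
  assumes "stochastic P"
  shows "0 \<le> mat_pow (- A) P n x y"
    and "ennreal (mat_pow (- A) P n x y) = (taboo_step P A ^^ n) (indicator {y}) x"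
proof -
  have "(\<forall>x. 0 \<le> mat_pow (- A) P n x y) \<and>
      (\<forall>x. ennreal (mat_pow (- A) P n x y) = (taboo_step P A ^^ n) (indicator {y}) x)"
  proof (induction n)
    case 0
    then show ?case by (simp add: ident_def indicator_def)
  next
    case (Suc n)
    let ?f = "\<lambda>x k. P x k * mat_pow (- A) P n k y"
    have eq: "(\<integral>\<^sup>+k. ennreal (?f x k) * indicator (- A) k \<partial>count_space UNIV) =
        (taboo_step P A ^^ Suc n) (indicator {y}) x" for x
      unfolding funpow.simps o_def taboo_step_def[of _ _ _ x]
      using Suc by (intro nn_integral_cong)
        (simp add: ennreal_mult' stochastic_nonneg assms mult.assoc)
    have "(taboo_step P A ^^ Suc n) (indicator {y}) x \<le> 1" for x
      by (rule taboo_power_le_const[OF assms]) (simp add: indicator_def)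
    then have "(taboo_step P A ^^ Suc n) (indicator {y}) x < \<infinity>" for x
      by (metis infinity_ennreal_def ennreal_one_less_top le_less_trans)
    then have fin: "(\<integral>\<^sup>+k. ennreal (?f x k) * indicator (- A) k \<partial>count_space UNIV) < \<infinity>" for x
      unfolding eq .
    show ?case
      using infsum_nn_integral(2)[OF _ fin] Suc
      by (auto simp: mat_mult_def eq stochastic_nonneg assms intro!: infsum_nonneg simp del: funpow.simps)
  qed
  then show "0 \<le> mat_pow (- A) P n x y"
    "ennreal (mat_pow (- A) P n x y) = (taboo_step P A ^^ n) (indicator {y}) x" by auto
qed

section \<open>Stationary chains and hitting times\<close>

locale stationary_chain =
  fixes P :: "'a::countable mat" and p :: "'a vec"
  assumes stoch: "stochastic P"
    and irred: "irreducible_chain P"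
    and inv: "invariant_prob P p"
begin

lemma p_nonneg: "0 \<le> p x"
  using inv by (simp add: invariant_prob_def prob_vector_def)

lemma P_nonneg: "0 \<le> P x y"
  by (rule stochastic_nonneg[OF stoch])

lemma mean_const: "mean p (\<lambda>_. c) = c"
proof -
  have "(\<integral>\<^sup>+x. ennreal (p x) \<partial>count_space UNIV) = ennreal 1"
    by (rule nn_integral_has_sum) (use inv in \<open>auto simp: invariant_prob_def prob_vector_def\<close>)
  then show ?thesis by (simp add: mean_def nn_integral_multc)
qed

text \<open>
  Invariance of \<open>p\<close>: one step of the killed chain loses exactly the mass that lands in \<open>A\<close>.
\<close>
lemma mean_taboo_step:
  "mean p (taboo_step P A f) + mean p (\<lambda>x. f x * indicator A x) = mean p f"
proof -
  let ?F = "\<lambda>(x, k). ennreal (p x) * (ennreal (P x k) * (f k * indicator (- A) k))"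
  have col: "(\<integral>\<^sup>+x. ennreal (p x) * ennreal (P x k) \<partial>count_space UNIV) = ennreal (p k)" for k
  proof -
    have "(\<integral>\<^sup>+x. ennreal (p x * P x k) \<partial>count_space UNIV) = ennreal (p k)"
      by (rule nn_integral_has_sum)
        (use inv in \<open>auto simp: invariant_prob_def p_nonneg P_nonneg\<close>)
    then show ?thesis by (simp add: ennreal_mult' p_nonneg)
  qed
  have "mean p (taboo_step P A f) =
      (\<integral>\<^sup>+x. \<integral>\<^sup>+k. ?F (x, k) \<partial>count_space UNIV \<partial>count_space UNIV)"
    unfolding mean_def taboo_step_def by (simp add: nn_integral_cmult)
  also have "\<dots> = (\<integral>\<^sup>+k. \<integral>\<^sup>+x. ?F (x, k) \<partial>count_space UNIV \<partial>count_space UNIV)"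
    by (simp only: nn_integral_fst_count_space nn_integral_snd_count_space)
  also have "\<dots> = (\<integral>\<^sup>+k. ennreal (p k) * (f k * indicator (- A) k) \<partial>count_space UNIV)"
    by (simp add: nn_integral_multc col mult.assoc[symmetric])
  finally have "mean p (taboo_step P A f) = mean p (\<lambda>k. f k * indicator (- A) k)"
    by (simp add: mean_def)
  then have "mean p (taboo_step P A f) + mean p (\<lambda>x. f x * indicator A x) =
      mean p (\<lambda>k. f k * indicator (- A) k + f k * indicator A k)"
    by (simp add: mean_add)
  also have "(\<lambda>k. f k * indicator (- A) k + f k * indicator A k) = f"
    by (auto simp: indicator_def)
  finally show ?thesis .
qed

text \<open>
  Telescoping of \<open>mean_taboo_step\<close>.
\<close>
lemma mean_taboo_power:
  "(\<Sum>n<N. mean p (\<lambda>x. (taboo_step P A ^^ n) f x * indicator A x)) +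
     mean p ((taboo_step P A ^^ N) f) = mean p f"
proof (induction N)
  case (Suc N)
  have "(\<Sum>n<Suc N. mean p (\<lambda>x. (taboo_step P A ^^ n) f x * indicator A x)) +
      mean p ((taboo_step P A ^^ Suc N) f) =
      (\<Sum>n<N. mean p (\<lambda>x. (taboo_step P A ^^ n) f x * indicator A x)) +
      (mean p (taboo_step P A ((taboo_step P A ^^ N) f)) +
       mean p (\<lambda>x. (taboo_step P A ^^ N) f x * indicator A x))"
    by (simp add: ac_simps)
  then show ?case by (simp only: mean_taboo_step Suc)
qed simp

lemma mean_potential_on_taboo:
  "mean p (\<lambda>x. potential P A f x * indicator A x) =
     (\<Sum>n. mean p (\<lambda>x. (taboo_step P A ^^ n) f x * indicator A x))"
  unfolding potential_def by (simp add: mean_suminf[symmetric] ennreal_suminf_multc)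

lemma kac_le: "mean p (\<lambda>x. potential P A f x * indicator A x) \<le> mean p f"
  unfolding mean_potential_on_taboo
proof (rule suminf_le_const)
  fix N
  show "(\<Sum>n<N. mean p (\<lambda>x. (taboo_step P A ^^ n) f x * indicator A x)) \<le> mean p f"
    unfolding mean_taboo_power[of A f N, symmetric] by (rule add_increasing2) simp_all
qed simp

text \<open>
  As \<open>N\<close> grows in \<open>mean_taboo_power\<close>, the remainder is the general term of the series
  \<open>mean p (potential P A f)\<close> and so vanishes. For \<open>f = 1\<close> this is Kac's formula, for indicators
  it expresses \<open>p\<close> through its restriction to \<open>A\<close>.
\<close>
lemma kac:
  assumes "mean p (potential P A f) < \<infinity>"
  shows "mean p (\<lambda>x. potential P A f x * indicator A x) = mean p f"
proof -
  have "(\<Sum>n. mean p ((taboo_step P A ^^ n) f)) < \<infinity>"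
    using assms unfolding potential_def[abs_def] by (simp add: mean_suminf)
  then have "(\<lambda>n. mean p ((taboo_step P A ^^ n) f)) \<longlonglongrightarrow> 0"
    by (rule tendsto_zero_of_finite_suminf)
  moreover have "(\<lambda>N. \<Sum>n<N. mean p (\<lambda>x. (taboo_step P A ^^ n) f x * indicator A x)) \<longlonglongrightarrow>
      mean p (\<lambda>x. potential P A f x * indicator A x)"
    unfolding mean_potential_on_taboo by (rule summable_LIMSEQ) simp
  ultimately have "(\<lambda>N. (\<Sum>n<N. mean p (\<lambda>x. (taboo_step P A ^^ n) f x * indicator A x)) +
      mean p ((taboo_step P A ^^ N) f)) \<longlonglongrightarrow> mean p (\<lambda>x. potential P A f x * indicator A x) + 0"
    by (intro tendsto_add)
  then show ?thesis
    unfolding mean_taboo_power by (simp add: LIMSEQ_const_iff)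
qed

lemma mat_pow_nonneg: "0 \<le> mat_pow UNIV P n x y"
  using mat_pow_taboo(1)[OF stoch, of "{}"] by simp

lemma ennreal_mat_pow: "ennreal (mat_pow UNIV P n x y) = (taboo_step P {} ^^ n) (indicator {y}) x"
  using mat_pow_taboo(2)[OF stoch, of "{}"] by simp

lemma mean_free_power: "mean p ((taboo_step P {} ^^ n) f) = mean p f"
  using mean_taboo_power[where A = "{}" and N = n and f = f] by (simp add: mean_def)

text \<open>
  Keep one term of \<open>p = p P\<^sup>n\<close>. The bound is uniform in \<open>n\<close> and provides the majorant for all later
  passages to the limit.
\<close>
lemma invariant_dominates: "p x * mat_pow UNIV P n x y \<le> p y"
proof -
  have "ennreal (p x) * ennreal (mat_pow UNIV P n x y) \<le>
      (\<integral>\<^sup>+k. ennreal (p k) * (taboo_step P {} ^^ n) (indicator {y}) k \<partial>count_space UNIV)"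
    unfolding ennreal_mat_pow by (rule nn_integral_ge_point) simp
  also have "\<dots> = mean p ((taboo_step P {} ^^ n) (indicator {y}))"
    by (simp add: mean_def)
  also have "\<dots> = ennreal (p y)"
    by (simp add: mean_free_power mean_indicator)
  finally show ?thesis
    by (simp add: ennreal_mult'[symmetric] p_nonneg)
qed

lemma p_pos: "0 < p x"
proof (rule ccontr)
  assume "\<not> 0 < p x"
  then have px: "p x = 0" using p_nonneg[of x] by simp
  have "p k = 0" for k
  proof -
    obtain n where "0 < mat_pow UNIV P n k x"
      using irred by (auto simp: irreducible_chain_def)
    moreover have "p k * mat_pow UNIV P n k x \<le> 0"
      using invariant_dominates[of k n x] px by simp
    ultimately show ?thesis using p_nonneg[of k] by (auto simp: mult_le_0_iff)
  qed
  then have "mean p (\<lambda>_. 1) = 0" by (simp add: mean_def)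
  then show False by (simp add: mean_const)
qed

lemma mean_finite_imp_finite:
  assumes "mean p f < \<infinity>"
  shows "f x < \<infinity>"
proof (rule ccontr)
  assume "\<not> f x < \<infinity>"
  then have "f x = \<top>" by (simp add: less_top[symmetric])
  then have "ennreal (p x) * f x = \<top>" using p_pos[of x] by (simp add: ennreal_mult_top)
  moreover have "ennreal (p x) * f x \<le> mean p f"
    unfolding mean_def by (rule nn_integral_ge_point) simp
  ultimately show False using assms by (simp add: top_unique)
qed

text \<open>
  If the harmonic function vanishes at \<open>x\<close>, then so do all terms of \<open>0 = (P\<^sup>n f)(x)\<close>, and irreducibility reaches
  every state.
\<close>
lemma harmonic_zero_everywhere:
  assumes "f = taboo_step P {} f" "f x = 0"
  shows "f y = 0"
proof -
  have pow: "(taboo_step P {} ^^ n) f = f" for n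
    by (induction n) (use assms(1) in auto)
  obtain n where n: "0 < mat_pow UNIV P n x y"
    using irred by (auto simp: irreducible_chain_def)
  have "ennreal (mat_pow UNIV P n x y) * f y \<le>
      (\<integral>\<^sup>+z. (taboo_step P {} ^^ n) (indicator {z}) x * f z \<partial>count_space UNIV)"
    unfolding ennreal_mat_pow by (rule nn_integral_ge_point) simp
  also have "\<dots> = 0" using taboo_power_kernel[of n P "{}" f x] by (simp add: pow assms(2))
  finally show ?thesis using n by (auto simp: ennreal_eq_0_iff)
qed

lemma survival_decreasing:
  "(taboo_step P A ^^ Suc n) (\<lambda>_. 1) x \<le> (taboo_step P A ^^ n) (\<lambda>_. 1) x"
  unfolding funpow_Suc_right o_def
  by (rule taboo_power_mono) (rule taboo_step_le_const[OF stoch], simp)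

text \<open>
  The survival probabilities decrease to some \<open>h\<close> with \<open>h = taboo_step P A h\<close>. Averaging this
  equation, \<open>mean_taboo_step\<close> forces \<open>h\<close> to vanish on \<open>A\<close>; then \<open>h\<close> is harmonic for the full chain
  and vanishes everywhere.
\<close>
lemma survival_tendsto_zero:
  assumes "A \<noteq> {}"
  shows "(\<lambda>n. (taboo_step P A ^^ n) (\<lambda>_. 1) x) \<longlonglongrightarrow> 0"
proof -
  define g where "g n = (taboo_step P A ^^ n) (\<lambda>_. 1)" for n
  define h where "h x = (INF n. g n x)" for x
  have le1: "g n x \<le> 1" for n x
    unfolding g_def by (rule taboo_power_le_const[OF stoch]) simp
  have dec: "decseq (\<lambda>n. g n x)" for x
    unfolding g_def by (intro decseq_SucI survival_decreasing)
  have lim: "(\<lambda>n. g n x) \<longlonglongrightarrow> h x" for x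
    unfolding h_def by (rule LIMSEQ_INF) (rule dec)
  have h: "h x = taboo_step P A h x" for x
  proof -
    have "(\<lambda>n. taboo_step P A (g n) x) \<longlonglongrightarrow> taboo_step P A h x"
      unfolding taboo_step_def
    proof (rule nn_integral_dominated_convergence[where w = "\<lambda>k. ennreal (P x k)"])
      show "AE k in count_space UNIV. ennreal (P x k) * (g j k * indicator (- A) k) \<le> ennreal (P x k)" for j
        using le1[of j] by (auto simp: AE_count_space indicator_def intro!: mult_left_le)
      show "(\<integral>\<^sup>+k. ennreal (P x k) \<partial>count_space UNIV) < \<infinity>"
        using taboo_step_one[OF stoch, of 1 x] by (simp add: taboo_step_def)
      show "AE k in count_space UNIV. (\<lambda>i. ennreal (P x k) * (g i k * indicator (- A) k))
          \<longlonglongrightarrow> ennreal (P x k) * (h k * indicator (- A) k)"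
        using lim by (auto simp: AE_count_space indicator_def intro!: ennreal_tendsto_cmult)
    qed auto
    moreover have "taboo_step P A (g n) = g (Suc n)" for n by (simp add: g_def)
    ultimately have "(\<lambda>n. g (Suc n) x) \<longlonglongrightarrow> taboo_step P A h x" by simp
    then show ?thesis using LIMSEQ_Suc[OF lim, of x] LIMSEQ_unique by blast
  qed
  have "mean p h \<le> mean p (\<lambda>_. 1)"
    by (rule mean_mono) (use le1 h_def in \<open>auto intro: INF_lower2\<close>)
  then have fin: "mean p h < \<infinity>" by (simp add: mean_const le_less_trans)
  have "mean p h + mean p (\<lambda>x. h x * indicator A x) = mean p h + 0"
    using mean_taboo_step[of A h] h by (metis (full_types) add_0_right ext)
  then have "mean p (\<lambda>x. h x * indicator A x) = 0"
    using fin by (auto simp: ennreal_add_left_cancel)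
  then have "ennreal (p x) * (h x * indicator A x) = 0" for x
    unfolding mean_def by (simp add: nn_integral_0_iff_AE AE_count_space)
  then have hA: "h x = 0" if "x \<in> A" for x
    using that p_pos[of x] by (metis (no_types, lifting) ennreal_eq_0_iff indicator_simps(1)
        less_le_not_le mult.right_neutral mult_eq_0_iff)
  then have "taboo_step P {} h x = taboo_step P A h x" for x
    unfolding taboo_step_def by (intro nn_integral_cong) (auto simp: indicator_def)
  then have "h = taboo_step P {} h" using h by auto
  moreover obtain a where "a \<in> A" using assms by blast
  ultimately have "h x = 0" using hA harmonic_zero_everywhere by blast
  then show ?thesis using lim[of x] unfolding g_def by simp
qed

text \<open>
  On \<open>A\<close> the expected return time is finite by \<open>kac_le\<close>. The set of states where it is infinite is
  disjoint from \<open>A\<close> and contains all predecessors of its elements, so by irreducibility it would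
  meet \<open>A\<close> if it were nonempty.
\<close>
lemma expected_hitting_time_finite:
  assumes "A \<noteq> {}"
  shows "potential P A (\<lambda>_. 1) x < \<infinity>"
proof (rule ccontr)
  let ?w = "potential P A (\<lambda>_. 1)"
  assume x: "\<not> ?w x < \<infinity>"
  have "mean p (\<lambda>x. ?w x * indicator A x) < \<infinity>"
    using kac_le[of A "\<lambda>_. 1"] by (simp add: mean_const le_less_trans)
  then have onA: "?w a < \<infinity>" if "a \<in> A" for a
    using mean_finite_imp_finite[of "\<lambda>x. ?w x * indicator A x" a] that by simp
  have "0 < mat_pow UNIV P n y x \<longrightarrow> ?w y = \<top>" for n y
  proof (induction n arbitrary: y)
    case 0
    then show ?case using x by (auto simp: ident_def less_top[symmetric])
  next
    case (Suc n)
    show ?case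
    proof
      assume "0 < mat_pow UNIV P (Suc n) y x"
      then have "0 < ennreal (mat_pow UNIV P (Suc n) y x)" by (simp del: mat_pow.simps)
      then have "0 < taboo_step P {} ((taboo_step P {} ^^ n) (indicator {x})) y"
        unfolding ennreal_mat_pow by simp
      then obtain k where k: "ennreal (P y k) * ennreal (mat_pow UNIV P n k x) \<noteq> 0"
        unfolding taboo_step_def[of _ _ _ y]
        by (auto simp: nn_integral_0_iff_AE AE_count_space zero_less_iff_neq_zero ennreal_mat_pow)
      then have Pk: "0 < P y k" and "0 < mat_pow UNIV P n k x"
        using P_nonneg[of y k] mat_pow_nonneg[of n k x] by (auto simp: order.order_iff_strict)
      then have wk: "?w k = \<top>" using Suc by simp
      then have "k \<notin> A" using onA by force
      have "ennreal (P y k) * (?w k * indicator (- A) k) \<le> taboo_step P A ?w y"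
        unfolding taboo_step_def by (rule nn_integral_ge_point) simp
      then have "taboo_step P A ?w y = \<top>"
        using Pk \<open>k \<notin> A\<close> wk by (simp add: ennreal_mult_top top_unique)
      then show "?w y = \<top>" by (subst potential_unfold) simp
    qed
  qed
  moreover obtain a where "a \<in> A" using assms by blast
  moreover obtain n where "0 < mat_pow UNIV P n a x"
    using irred by (auto simp: irreducible_chain_def)
  ultimately show False using onA by force
qed

text \<open>
  Go to \<open>i\<close> first and from there to \<open>A\<close>. The bound is proved for the partial sums of the left-hand
  side, which at \<open>i\<close> are at most \<open>potential P A (\<lambda>_. 1) i\<close>.
\<close>
lemma hitting_time_le:
  "potential P A (\<lambda>_. 1) x \<le> potential P {i} (\<lambda>_. 1) x + potential P A (\<lambda>_. 1) i"
proof -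
  let ?w = "potential P A (\<lambda>_. 1)" and ?v = "potential P {i} (\<lambda>_. 1)"
  let ?s = "\<lambda>n x. \<Sum>k<n. (taboo_step P A ^^ k) (\<lambda>_. 1) x"
  \<comment> \<open>At \<open>i\<close> itself the induction hypothesis is too weak, as the journey to \<open>i\<close> would be counted anew.\<close>
  have si: "?s n i \<le> ?w i" for n
    unfolding potential_def by (intro sum_le_suminf) auto
  have "?s n x \<le> ?v x + ?w i" for n
  proof (induction n arbitrary: x)
    case (Suc n)
    have "?s (Suc n) x = 1 + taboo_step P A (?s n) x" by (rule partial_potential_Suc)
    also have "taboo_step P A (?s n) x \<le> taboo_step P A (\<lambda>k. ?v k * indicator (- {i}) k + ?w i) x"
      by (rule taboo_step_mono) (use Suc si in \<open>auto simp: indicator_def\<close>)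
    also have "\<dots> = taboo_step P A (\<lambda>k. ?v k * indicator (- {i}) k) x + taboo_step P A (\<lambda>_. ?w i) x"
      by (rule taboo_step_add)
    also have "taboo_step P A (\<lambda>_. ?w i) x \<le> ?w i"
      by (rule taboo_step_le_const[OF stoch]) simp
    also have "taboo_step P A (\<lambda>k. ?v k * indicator (- {i}) k) x \<le>
        taboo_step P {} (\<lambda>k. ?v k * indicator (- {i}) k) x"
      by (rule taboo_step_antimono_taboo) simp
    also have "taboo_step P {} (\<lambda>k. ?v k * indicator (- {i}) k) x = taboo_step P {i} ?v x"
      by (simp add: taboo_step_def)
    finally have "?s (Suc n) x \<le> 1 + taboo_step P {i} ?v x + ?w i"
      by (simp add: add.assoc add_mono)
    then show ?case by (subst potential_unfold)
  qed simp
  then show ?thesis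
    unfolding potential_def[of P A] by (intro suminf_le_const) auto
qed

end

section \<open>Return times on path space\<close>

lemma sets_path_event:
  "{\<omega>. (\<forall>k\<le>m. \<omega> k = x k) \<and> (\<forall>k\<in>{m<..m + n}. \<omega> k \<noteq> i)} \<in>
     sets (PiM UNIV (\<lambda>_::nat. count_space (UNIV :: 'a::countable set)))"
proof -
  have "{\<omega> \<in> space (PiM UNIV (\<lambda>_::nat. count_space (UNIV :: 'a set))).
      (\<forall>k\<in>{..m}. \<omega> k = x k) \<and> (\<forall>k\<in>{m<..m + n}. \<omega> k \<noteq> i)} \<in>
      sets (PiM UNIV (\<lambda>_::nat. count_space (UNIV :: 'a set)))"
    by measurable
  then show ?thesis by (simp add: space_PiM atMost_def)
qed

text \<open>
  Conditioning on the state at time \<open>m + 1\<close> extends the prescribed initial segment by one step,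
  which lets the induction on \<open>n\<close> start from the cylinder formula.
\<close>
lemma emeasure_avoid_after:
  fixes P :: "'a::countable mat"
  assumes "stochastic P" "prob_vector \<mu>"
  shows "emeasure (chain_law P \<mu>)
      {\<omega>. (\<forall>k\<le>m. \<omega> k = x k) \<and> (\<forall>k\<in>{m<..m + n}. \<omega> k \<noteq> i)} =
    ennreal (\<mu> (x 0) * (\<Prod>k<m. P (x k) (x (Suc k)))) * (taboo_step P {i} ^^ n) (\<lambda>_. 1) (x m)"
proof (induction n arbitrary: m x)
  case 0
  then show ?case using emeasure_chain_law_cylinder[OF assms] by simp
next
  case (Suc n)
  define c where "c = \<mu> (x 0) * (\<Prod>k<m. P (x k) (x (Suc k)))"
  have c: "0 \<le> c"
    unfolding c_def using assms
    by (auto simp: stochastic_def prob_vector_def intro!: mult_nonneg_nonneg prod_nonneg)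
  define X where "X y = {\<omega>. (\<forall>k\<le>Suc m. \<omega> k = (x(Suc m := y)) k) \<and>
      (\<forall>k\<in>{Suc m<..Suc m + n}. \<omega> k \<noteq> i)}" for y
  have split: "{\<omega>. (\<forall>k\<le>m. \<omega> k = x k) \<and> (\<forall>k\<in>{m<..m + Suc n}. \<omega> k \<noteq> i)} = (\<Union>y\<in>- {i}. X y)"
  proof (intro set_eqI iffI)
    fix \<omega> assume \<omega>: "\<omega> \<in> {\<omega>. (\<forall>k\<le>m. \<omega> k = x k) \<and> (\<forall>k\<in>{m<..m + Suc n}. \<omega> k \<noteq> i)}"
    then have "\<omega> \<in> X (\<omega> (Suc m))" by (auto simp: X_def le_Suc_eq)
    moreover have "\<omega> (Suc m) \<noteq> i" using \<omega> by auto
    ultimately show "\<omega> \<in> (\<Union>y\<in>- {i}. X y)" by blast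
  next
    fix \<omega> assume "\<omega> \<in> (\<Union>y\<in>- {i}. X y)"
    then obtain y where y: "y \<noteq> i" "\<omega> \<in> X y" by blast
    have "\<omega> k \<noteq> i" if "k \<in> {m<..m + Suc n}" for k
      using that y by (cases "k = Suc m") (auto simp: X_def)
    moreover have "\<omega> k = x k" if "k \<le> m" for k
      using that y by (auto simp: X_def)
    ultimately show "\<omega> \<in> {\<omega>. (\<forall>k\<le>m. \<omega> k = x k) \<and> (\<forall>k\<in>{m<..m + Suc n}. \<omega> k \<noteq> i)}" by blast
  qed
  have "emeasure (chain_law P \<mu>) (\<Union>y\<in>- {i}. X y) =
      (\<integral>\<^sup>+y. emeasure (chain_law P \<mu>) (X y) \<partial>count_space (- {i}))"
  proof (rule emeasure_UN_countable)
    show "X y \<in> sets (chain_law P \<mu>)" for y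
      unfolding X_def sets_chain_law[OF assms] by (rule sets_path_event)
    show "disjoint_family_on X (- {i})"
      by (auto simp: disjoint_family_on_def X_def)
  qed simp
  also have "\<dots> = (\<integral>\<^sup>+y. ennreal c * (ennreal (P (x m) y) *
      ((taboo_step P {i} ^^ n) (\<lambda>_. 1) y * indicator (- {i}) y)) \<partial>count_space UNIV)"
  proof (subst nn_integral_count_space_indicator, simp, rule nn_integral_cong)
    fix y
    have "(\<Prod>k<Suc m. P ((x(Suc m := y)) k) ((x(Suc m := y)) (Suc k))) =
        (\<Prod>k<m. P (x k) (x (Suc k))) * P (x m) y"
      by simp
    then have "emeasure (chain_law P \<mu>) (X y) =
        ennreal (c * P (x m) y) * (taboo_step P {i} ^^ n) (\<lambda>_. 1) y"
      unfolding X_def by (subst Suc) (simp add: c_def mult.assoc)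
    then show "emeasure (chain_law P \<mu>) (X y) * indicator (- {i}) y = ennreal c * (ennreal (P (x m) y) *
      ((taboo_step P {i} ^^ n) (\<lambda>_. 1) y * indicator (- {i}) y))"
      using c by (simp add: ennreal_mult' mult.assoc)
  qed
  also have "\<dots> = ennreal c * (taboo_step P {i} ^^ Suc n) (\<lambda>_. 1) (x m)"
    by (simp add: nn_integral_cmult taboo_step_def[of _ _ _ "x m"])
  finally show ?case unfolding split c_def by simp
qed

lemma emeasure_avoid:
  fixes P :: "'a::countable mat"
  assumes "stochastic P" "prob_vector \<mu>"
  shows "emeasure (chain_law P \<mu>) {\<omega>. \<forall>k\<in>{0<..n}. \<omega> k \<noteq> i} =
    mean \<mu> ((taboo_step P {i} ^^ n) (\<lambda>_. 1))"
proof -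
  define X where "X y = {\<omega>. (\<forall>k\<le>0. \<omega> k = (\<lambda>_::nat. y) k) \<and> (\<forall>k\<in>{0<..0 + n}. \<omega> k \<noteq> i)}" for y
  have "{\<omega>. \<forall>k\<in>{0<..n}. \<omega> k \<noteq> i} = (\<Union>y\<in>UNIV. X y)" by (auto simp: X_def)
  also have "emeasure (chain_law P \<mu>) \<dots> =
      (\<integral>\<^sup>+y. emeasure (chain_law P \<mu>) (X y) \<partial>count_space UNIV)"
  proof (rule emeasure_UN_countable)
    show "X y \<in> sets (chain_law P \<mu>)" for y
      unfolding X_def sets_chain_law[OF assms] by (rule sets_path_event)
    show "disjoint_family_on X UNIV"
      by (auto simp: disjoint_family_on_def X_def)
  qed simp
  also have "\<dots> = mean \<mu> ((taboo_step P {i} ^^ n) (\<lambda>_. 1))"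
    unfolding X_def emeasure_avoid_after[OF assms] mean_def by simp
  finally show ?thesis .
qed

text \<open>
  The tail sum of the return time: the events that \<open>i\<close> is avoided at the times \<open>1, \<dots>, n\<close> count, as \<open>n\<close>
  varies, at most \<open>k\<close> times on paths with \<open>\<omega> k = i\<close>.
\<close>
lemma (in stationary_chain) mean_hitting_time_le_expected_return_time:
  "mean p (potential P {i} (\<lambda>_. 1)) \<le> expected_return_time P p i"
proof -
  let ?E = "\<lambda>n. {\<omega>. \<forall>k\<in>{0::nat<..n}. \<omega> k \<noteq> i}"
  have prob: "prob_vector p" using inv by (simp add: invariant_prob_def)
  have E: "?E n \<in> sets (chain_law P p)" for n
  proof -
    have "{\<omega> \<in> space (PiM UNIV (\<lambda>_::nat. count_space (UNIV :: 'a set))). \<forall>k\<in>{0<..n}. \<omega> k \<noteq> i}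
        \<in> sets (PiM UNIV (\<lambda>_::nat. count_space (UNIV :: 'a set)))"
      by measurable
    then show ?thesis unfolding sets_chain_law[OF stoch prob] by (simp add: space_PiM)
  qed
  have "mean p (potential P {i} (\<lambda>_. 1)) = (\<Sum>n. emeasure (chain_law P p) (?E n))"
    unfolding potential_def[abs_def] by (simp add: mean_suminf emeasure_avoid[OF stoch prob])
  also have "\<dots> = (\<Sum>n. \<integral>\<^sup>+\<omega>. indicator (?E n) \<omega> \<partial>chain_law P p)"
    by (simp only: nn_integral_indicator[OF E])
  also have "\<dots> = (\<integral>\<^sup>+\<omega>. (\<Sum>n. indicator (?E n) \<omega>) \<partial>chain_law P p)"
    by (rule nn_integral_suminf[symmetric]) (intro borel_measurable_indicator E)
  also have "\<dots> \<le> expected_return_time P p i"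
    unfolding expected_return_time_def return_time_def
  proof (intro nn_integral_mono INF_greatest)
    fix \<omega> :: "nat \<Rightarrow> 'a" and k assume k: "k \<in> {k. 1 \<le> k \<and> \<omega> k = i}"
    have "(\<Sum>n. indicator (?E n) \<omega> :: ennreal) = (\<Sum>n<k. indicator (?E n) \<omega>)"
      by (rule suminf_finite) (use k in \<open>auto simp: indicator_def\<close>)
    also have "\<dots> \<le> (\<Sum>n<k. 1)"
      by (rule sum_mono) (simp add: indicator_def)
    finally show "(\<Sum>n. indicator (?E n) \<omega>) \<le> (of_nat k :: ennreal)" by simp
  qed
  finally show ?thesis .
qed

section \<open>Convergence to the invariant vector\<close>

text \<open>
  The least gap \<open>d\<close> between elements of \<open>S\<close> divides every \<open>s \<in> S\<close>: otherwise combining \<open>s\<close> with multiples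
  of \<open>m\<close> and \<open>m + d\<close> produces the smaller gap \<open>d - s mod d\<close>. Hence \<open>d = 1\<close>, and two
  consecutive elements \<open>m\<close>, \<open>m + 1\<close> generate all numbers from \<open>m\<^sup>2\<close> on.
\<close>
lemma additive_gcd_one_cofinite:
  fixes S :: "nat set"
  assumes add: "\<And>a b. a \<in> S \<Longrightarrow> b \<in> S \<Longrightarrow> a + b \<in> S" and "0 \<notin> S" and gcd: "Gcd S = 1"
  obtains N where "\<And>n. N \<le> n \<Longrightarrow> n \<in> S"
proof -
  have mult: "Suc k * a \<in> S" if "a \<in> S" for k a
  proof (induction k)
    case (Suc k)
    then show ?case using add[OF that Suc] by simp
  qed (simp add: that)
  define gap where "gap d \<longleftrightarrow> 0 < d \<and> (\<exists>m\<in>S. m + d \<in> S)" for d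
  have "S \<noteq> {}" using gcd by auto
  then obtain s where s: "s \<in> S" by blast
  then have "gap s" using add assms(2) unfolding gap_def by (metis gr0I)
  define d where "d = (LEAST d. gap d)"
  from \<open>gap s\<close> have "gap d" unfolding d_def by (rule LeastI)
  then obtain m where m: "m \<in> S" "m + d \<in> S" and d: "0 < d"
    unfolding gap_def by blast
  have "d dvd s" if s: "s \<in> S" for s
  proof (rule ccontr)
    assume "\<not> d dvd s"
    then have r: "0 < s mod d" "s mod d < d" using d by (auto simp: dvd_eq_mod_eq_0)
    let ?q = "s div d"
    have eq: "(Suc ?q * m + s) + (d - s mod d) = Suc ?q * (m + d)"
    proof -
      have "s + (d - s mod d) = d * ?q + d"
        using r mult_div_mod_eq[of d s] by linarith
      then show ?thesis by (simp add: algebra_simps)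
    qed
    have "Suc ?q * m + s \<in> S" "Suc ?q * (m + d) \<in> S" using mult m s add by blast+
    then have "(Suc ?q * m + s) + (d - s mod d) \<in> S" by (simp only: eq)
    then have "gap (d - s mod d)"
      unfolding gap_def using r \<open>Suc ?q * m + s \<in> S\<close> by (intro conjI bexI[of _ "Suc ?q * m + s"]) simp_all
    then have "d \<le> d - s mod d" unfolding d_def by (rule Least_le)
    then show False using r by linarith
  qed
  then have "d dvd Gcd S" by (rule Gcd_greatest)
  then have "d = 1" using gcd by simp
  then have m1: "m + 1 \<in> S" and m0: "0 < m" using m assms(2) by (auto intro: gr0I)
  have "n \<in> S" if n: "m * m \<le> n" for n
  proof -
    let ?q = "n div m" and ?r = "n mod m"
    have r: "?r < m" using m0 by simp
    have q: "m \<le> ?q" using n m0 by (metis div_le_mono nonzero_mult_div_cancel_left less_numeral_extra(3))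
    have "n = m * ?q + ?r" by simp
    also have "\<dots> = (?q - ?r) * m + ?r * (m + 1)"
    proof -
      have "(?q - ?r) * m + ?r * m = ?q * m" using q r by (simp add: add_mult_distrib[symmetric])
      then show ?thesis by (simp add: algebra_simps)
    qed
    finally have n: "n = (?q - ?r) * m + ?r * (m + 1)" .
    obtain k where k: "?q - ?r = Suc k" using q r by (metis Suc_diff_Suc order.strict_trans2)
    have "(?q - ?r) * m \<in> S" unfolding k by (rule mult[OF m(1)])
    then show ?thesis
    proof (cases ?r)
      case 0
      then show ?thesis using \<open>(?q - ?r) * m \<in> S\<close> n by simp
    next
      case (Suc l)
      have "Suc l * (m + 1) \<in> S" by (rule mult[OF m1])
      then show ?thesis using \<open>(?q - ?r) * m \<in> S\<close> n add Suc by metis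
    qed
  qed
  then show ?thesis using that by blast
qed

definition product_kernel :: "'a mat \<Rightarrow> ('a \<times> 'a) mat" where
  "product_kernel P = (\<lambda>(x, y) (x', y'). P x x' * P y y')"

definition product_vec :: "'a vec \<Rightarrow> ('a \<times> 'a) vec" where
  "product_vec p = (\<lambda>(x, y). p x * p y)"

context
  fixes P :: "'a::countable mat" and p :: "'a vec"
  assumes stoch: "stochastic P"
begin

lemma product_step:
  "taboo_step (product_kernel P) {} (\<lambda>(k, l). f k * g l) (x, y) =
     taboo_step P {} f x * taboo_step P {} g y"
proof -
  have "taboo_step (product_kernel P) {} (\<lambda>(k, l). f k * g l) (x, y) =
      (\<integral>\<^sup>+z. (case z of (k, l) \<Rightarrow> (ennreal (P x k) * f k) * (ennreal (P y l) * g l)) \<partial>count_space UNIV)"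
    unfolding taboo_step_def
    by (intro nn_integral_cong)
      (auto simp: product_kernel_def ennreal_mult' stochastic_nonneg[OF stoch] ac_simps)
  then show ?thesis by (simp add: nn_integral_product taboo_step_def)
qed

lemma product_power:
  "(taboo_step (product_kernel P) {} ^^ n) (\<lambda>(k, l). f k * g l) (x, y) =
     (taboo_step P {} ^^ n) f x * (taboo_step P {} ^^ n) g y"
proof (induction n arbitrary: x y)
  case (Suc n)
  then have "(taboo_step (product_kernel P) {} ^^ n) (\<lambda>(k, l). f k * g l) =
      (\<lambda>(k, l). (taboo_step P {} ^^ n) f k * (taboo_step P {} ^^ n) g l)"
    by (auto simp: fun_eq_iff)
  then show ?case by (simp add: product_step)
qed simp

lemma product_kernel_nonneg: "0 \<le> product_kernel P z z'"
  by (auto simp: product_kernel_def stochastic_nonneg[OF stoch] split: prod.split)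

lemma stochastic_product_kernel: "stochastic (product_kernel P)"
  unfolding stochastic_def prob_vector_def
proof (intro allI conjI)
  fix z :: "'a \<times> 'a"
  obtain x y where z: "z = (x, y)" by (cases z)
  have "taboo_step (product_kernel P) {} (\<lambda>(k, l). 1 * 1) (x, y) = 1"
    by (subst product_step) (simp add: taboo_step_one[OF stoch])
  then have "(\<integral>\<^sup>+z'. ennreal (product_kernel P z z') \<partial>count_space UNIV) = ennreal 1"
    by (simp add: taboo_step_def z case_prod_beta)
  then show "(product_kernel P z has_sum 1) UNIV"
    by (intro has_sum_nn_integral product_kernel_nonneg) simp
qed (rule product_kernel_nonneg)

lemma invariant_product:
  assumes "invariant_prob P p"
  shows "invariant_prob (product_kernel P) (product_vec p)"
proof -
  have p: "0 \<le> p x" for x using assms by (simp add: invariant_prob_def prob_vector_def)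
  have p1: "(\<integral>\<^sup>+x. ennreal (p x) \<partial>count_space UNIV) = ennreal 1"
    by (rule nn_integral_has_sum) (use assms p in \<open>auto simp: invariant_prob_def prob_vector_def\<close>)
  have pP: "(\<integral>\<^sup>+x. ennreal (p x * P x k) \<partial>count_space UNIV) = ennreal (p k)" for k
    by (rule nn_integral_has_sum)
      (use assms p in \<open>auto simp: invariant_prob_def stochastic_nonneg[OF stoch]\<close>)
  have nonneg: "0 \<le> product_vec p z" for z
    by (auto simp: product_vec_def p split: prod.split)
  have "(\<integral>\<^sup>+z. ennreal (product_vec p z) \<partial>count_space UNIV) =
      (\<integral>\<^sup>+z. (case z of (k, l) \<Rightarrow> ennreal (p k) * ennreal (p l)) \<partial>count_space UNIV)"
    by (intro nn_integral_cong) (auto simp: product_vec_def ennreal_mult' p)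
  also have "\<dots> = ennreal 1" by (simp add: nn_integral_product p1)
  finally have "(product_vec p has_sum 1) UNIV"
    by (intro has_sum_nn_integral nonneg) simp
  moreover have "((\<lambda>z. product_vec p z * product_kernel P z z') has_sum product_vec p z') UNIV" for z'
  proof -
    obtain k l where z': "z' = (k, l)" by (cases z')
    have "(\<integral>\<^sup>+z. ennreal (product_vec p z * product_kernel P z z') \<partial>count_space UNIV) =
      (\<integral>\<^sup>+z. (case z of (x, y) \<Rightarrow> ennreal (p x * P x k) * ennreal (p y * P y l)) \<partial>count_space UNIV)"
      by (intro nn_integral_cong)
        (auto simp: product_vec_def product_kernel_def z' ennreal_mult' p stochastic_nonneg[OF stoch] ac_simps)
    also have "\<dots> = ennreal (product_vec p z')"
      by (simp add: nn_integral_product pP z' product_vec_def ennreal_mult'[of "p k"] p)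
    finally show ?thesis
      by (intro has_sum_nn_integral nonneg mult_nonneg_nonneg product_kernel_nonneg)
  qed
  ultimately show ?thesis by (simp add: invariant_prob_def prob_vector_def nonneg)
qed

lemma mat_pow_product:
  "ennreal (mat_pow UNIV (product_kernel P) n (x, y) (x', y')) =
     ennreal (mat_pow UNIV P n x x' * mat_pow UNIV P n y y')"
proof -
  have ind: "indicator {(x', y')} = (\<lambda>(k, l). indicator {x'} k * indicator {y'} l :: ennreal)"
    by (auto simp: indicator_def fun_eq_iff)
  have "ennreal (mat_pow UNIV (product_kernel P) n (x, y) (x', y')) =
      (taboo_step (product_kernel P) {} ^^ n) (indicator {(x', y')}) (x, y)"
    using mat_pow_taboo(2)[OF stochastic_product_kernel, of "{}"] by simp
  also have "\<dots> = ennreal (mat_pow UNIV P n x x') * ennreal (mat_pow UNIV P n y y')"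
    unfolding ind product_power using mat_pow_taboo(2)[OF stoch, of "{}"] by simp
  finally show ?thesis
    using mat_pow_taboo(1)[OF stoch, of "{}" n x x'] by (simp add: ennreal_mult')
qed

end

context stationary_chain
begin

lemma mat_pow_add_ge:
  "mat_pow UNIV P m x y * mat_pow UNIV P n y z \<le> mat_pow UNIV P (m + n) x z"
proof -
  let ?L = "taboo_step P {}"
  have "ennreal (mat_pow UNIV P m x y * mat_pow UNIV P n y z) =
      (?L ^^ m) (indicator {y}) x * (?L ^^ n) (indicator {z}) y"
    by (simp add: ennreal_mult' mat_pow_nonneg ennreal_mat_pow)
  also have "\<dots> \<le> (\<integral>\<^sup>+k. (?L ^^ m) (indicator {k}) x * (?L ^^ n) (indicator {z}) k \<partial>count_space UNIV)"
    by (rule nn_integral_ge_point) simp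
  also have "\<dots> = ennreal (mat_pow UNIV P (m + n) x z)"
    by (simp add: taboo_power_kernel[symmetric] ennreal_mat_pow funpow_add)
  finally show ?thesis by (simp add: mat_pow_nonneg)
qed

text \<open>
  Irreducibility alone yields some \<open>n\<close> for each pair of states; the product chain needs one \<open>n\<close> that
  serves two pairs simultaneously.
\<close>
lemma eventually_mat_pow_pos:
  assumes "aperiodic_chain P"
  shows "\<exists>N. \<forall>n\<ge>N. 0 < mat_pow UNIV P n x y"
proof -
  define S where "S = {n::nat. 1 \<le> n \<and> 0 < mat_pow UNIV P n x x}"
  have "a + b \<in> S" if "a \<in> S" "b \<in> S" for a b
  proof -
    have "0 < mat_pow UNIV P a x x * mat_pow UNIV P b x x" using that by (simp add: S_def)
    also have "\<dots> \<le> mat_pow UNIV P (a + b) x x" by (rule mat_pow_add_ge)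
    finally show ?thesis using that by (simp add: S_def)
  qed
  moreover have "0 \<notin> S" by (simp add: S_def)
  moreover have "Gcd S = 1" using assms by (simp add: S_def aperiodic_chain_def)
  ultimately obtain N where N: "\<And>n. N \<le> n \<Longrightarrow> n \<in> S"
    by (rule additive_gcd_one_cofinite) blast+
  obtain m where m: "0 < mat_pow UNIV P m x y"
    using irred by (auto simp: irreducible_chain_def)
  have "0 < mat_pow UNIV P n x y" if n: "N + m \<le> n" for n
  proof -
    have "0 < mat_pow UNIV P (n - m) x x" using N[of "n - m"] n by (simp add: S_def)
    then have "0 < mat_pow UNIV P (n - m) x x * mat_pow UNIV P m x y" using m by simp
    then show ?thesis using mat_pow_add_ge[of "n - m" x x m y] n by simp
  qed
  then show ?thesis by blast
qed

lemma irreducible_product: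
  assumes "aperiodic_chain P"
  shows "irreducible_chain (product_kernel P)"
  unfolding irreducible_chain_def
proof (intro allI)
  fix z z' :: "'a \<times> 'a"
  obtain x y x' y' where z: "z = (x, y)" "z' = (x', y')" by (cases z, cases z')
  obtain N where N: "\<forall>n\<ge>N. 0 < mat_pow UNIV P n x x'"
    using eventually_mat_pow_pos[OF assms] by blast
  obtain M where M: "\<forall>n\<ge>M. 0 < mat_pow UNIV P n y y'"
    using eventually_mat_pow_pos[OF assms] by blast
  have "0 < mat_pow UNIV P (max M N) x x' * mat_pow UNIV P (max M N) y y'"
    using M N by simp
  then have "0 < mat_pow UNIV (product_kernel P) (max M N) z z'"
    using mat_pow_product[OF stoch, of "max M N" x y x' y'] unfolding z
    by (metis ennreal_less_zero_iff)
  then show "\<exists>n. 0 < mat_pow UNIV (product_kernel P) n z z'" by blast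
qed

text \<open>
  Once the two copies have met they may be taken to move together, so the starting point only
  matters on the event that the diagonal (the relation \<open>Id\<close>) has been avoided. In the form of an
  upper bound the statement needs no subtraction and follows by induction on \<open>n\<close>.
\<close>
lemma coupling_inequality:
  assumes "\<And>k. f k \<le> 1"
  shows "(taboo_step P {} ^^ n) f x \<le>
     (taboo_step P {} ^^ n) f y + (taboo_step (product_kernel P) Id ^^ n) (\<lambda>_. 1) (x, y)"
proof (induction n arbitrary: x y)
  case 0
  then show ?case using assms by (simp add: add_increasing)
next
  case (Suc n)
  let ?D = "Id :: ('a \<times> 'a) set"
  let ?a = "(taboo_step P {} ^^ n) f" and ?g = "(taboo_step (product_kernel P) ?D ^^ n) (\<lambda>_. 1)"
  have "taboo_step P {} ?a x = taboo_step (product_kernel P) {} (\<lambda>(k, l). ?a k * 1) (x, y)"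
    by (subst product_step[OF stoch]) (simp add: taboo_step_one[OF stoch])
  also have "\<dots> \<le> taboo_step (product_kernel P) {}
      (\<lambda>z. (case z of (k, l) \<Rightarrow> 1 * ?a l) + ?g z * indicator (- ?D) z) (x, y)"
    by (rule taboo_step_mono) (use Suc in \<open>auto simp: indicator_def\<close>)
  also have "\<dots> = taboo_step (product_kernel P) {} (\<lambda>(k, l). 1 * ?a l) (x, y) +
      taboo_step (product_kernel P) {} (\<lambda>z. ?g z * indicator (- ?D) z) (x, y)"
    by (rule taboo_step_add)
  also have "taboo_step (product_kernel P) {} (\<lambda>(k, l). 1 * ?a l) (x, y) = taboo_step P {} ?a y"
    by (subst product_step[OF stoch]) (simp add: taboo_step_one[OF stoch])
  also have "taboo_step (product_kernel P) {} (\<lambda>z. ?g z * indicator (- ?D) z) (x, y) =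
      taboo_step (product_kernel P) ?D ?g (x, y)"
    by (simp add: taboo_step_def)
  finally show ?case by simp
qed

text \<open>
  Since \<open>p j\<close> is the \<open>p\<close>-mean of \<open>y \<mapsto> P\<^sup>n(y, j)\<close>, averaging the coupling inequality over the starting point of one
  copy bounds \<open>P\<^sup>n(i, j) - p j\<close> from both sides by the mean probability of not having met.
\<close>
theorem mat_pow_tendsto:
  assumes "aperiodic_chain P"
  shows "(\<lambda>n. mat_pow UNIV P n i j) \<longlonglongrightarrow> p j"
proof -
  interpret prod: stationary_chain "product_kernel P" "product_vec p"
    by unfold_locales
      (rule stochastic_product_kernel[OF stoch] irreducible_product[OF assms] invariant_product[OF stoch inv])+
  let ?D = "Id :: ('a \<times> 'a) set"
  define g where "g n = (taboo_step (product_kernel P) ?D ^^ n) (\<lambda>_. 1)" for n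
  have g0: "(\<lambda>n. g n z) \<longlonglongrightarrow> 0" for z
    unfolding g_def by (rule prod.survival_tendsto_zero) auto
  have g1: "g n z \<le> 1" for n z
    unfolding g_def by (rule taboo_power_le_const[OF prod.stoch]) simp
  let ?M = "\<lambda>n. (taboo_step P {} ^^ n) (indicator {j})"
  have coup: "?M n x \<le> ?M n y + g n (x, y)" for n x y
    unfolding g_def by (rule coupling_inequality) (simp add: indicator_def)
  have lim: "(\<lambda>n. mean p (\<lambda>y. g n (h y))) \<longlonglongrightarrow> 0" for h
  proof -
    have "(\<lambda>n. mean p (\<lambda>y. g n (h y))) \<longlonglongrightarrow> (\<integral>\<^sup>+y. 0 \<partial>count_space (UNIV :: 'a set))"
      unfolding mean_def
    proof (rule nn_integral_dominated_convergence[where w = "\<lambda>y. ennreal (p y)"])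
      show "AE y in count_space UNIV. ennreal (p y) * g n (h y) \<le> ennreal (p y)" for n
        by (simp add: AE_count_space mult_left_le g1)
      show "(\<integral>\<^sup>+y. ennreal (p y) \<partial>count_space UNIV) < \<infinity>"
        using mean_const[of 1] by (simp add: mean_def)
      show "AE y in count_space UNIV. (\<lambda>n. ennreal (p y) * g n (h y)) \<longlonglongrightarrow> 0"
      proof -
        have "(\<lambda>n. ennreal (p y) * g n (h y)) \<longlonglongrightarrow> ennreal (p y) * 0" for y
          by (rule ennreal_tendsto_cmult) (simp_all add: g0)
        then show ?thesis by (simp add: AE_count_space)
      qed
    qed auto
    then show ?thesis by simp
  qed
  have pj: "mean p (?M n) = ennreal (p j)" for n
    by (simp add: mean_free_power mean_indicator)
  have fin: "mean p (\<lambda>y. g n (h y)) \<le> 1" for n h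
    using mean_mono[of "\<lambda>y. g n (h y)" "\<lambda>_. 1" p, OF g1] by (simp add: mean_const)
  define e where "e n = enn2real (mean p (\<lambda>y. g n (i, y))) + enn2real (mean p (\<lambda>y. g n (y, i)))" for n
  have enn: "ennreal (enn2real (mean p (\<lambda>y. g n (h y)))) = mean p (\<lambda>y. g n (h y))" for n h
    using le_less_trans[OF fin[of n h]] by simp
  have e0: "(\<lambda>n. enn2real (mean p (\<lambda>y. g n (h y)))) \<longlonglongrightarrow> 0" for h
    using lim[of h] by (subst ennreal_tendsto_0_iff[symmetric]) (simp_all add: enn)
  have le: "a \<le> b + c" if "ennreal a \<le> ennreal b + ennreal c" "0 \<le> b" "0 \<le> c" for a b c
    using that by (metis add_nonneg_nonneg ennreal_le_iff ennreal_plus)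
  have bound: "\<bar>mat_pow UNIV P n i j - p j\<bar> \<le> e n" for n
  proof -
    have "mean p (\<lambda>_. ?M n i) \<le> mean p (\<lambda>y. ?M n y + g n (i, y))"
      by (rule mean_mono) (rule coup)
    then have "ennreal (mat_pow UNIV P n i j) \<le> ennreal (p j) + ennreal (enn2real (mean p (\<lambda>y. g n (i, y))))"
      by (simp add: mean_const mean_add pj ennreal_mat_pow enn)
    then have 1: "mat_pow UNIV P n i j \<le> p j + enn2real (mean p (\<lambda>y. g n (i, y)))"
      by (rule le) (simp_all add: p_nonneg)
    have "mean p (?M n) \<le> mean p (\<lambda>y. ?M n i + g n (y, i))"
      by (rule mean_mono) (rule coup)
    then have "ennreal (p j) \<le> ennreal (mat_pow UNIV P n i j) + ennreal (enn2real (mean p (\<lambda>y. g n (y, i))))"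
      by (simp add: mean_const mean_add pj ennreal_mat_pow enn)
    then have 2: "p j \<le> mat_pow UNIV P n i j + enn2real (mean p (\<lambda>y. g n (y, i)))"
      by (rule le) (simp_all add: mat_pow_nonneg)
    show ?thesis using 1 2 unfolding e_def by (smt (verit) enn2real_nonneg)
  qed
  have "e \<longlonglongrightarrow> 0"
    unfolding e_def using tendsto_add[OF e0[of "\<lambda>y. (i, y)"] e0[of "\<lambda>y. (y, i)"]] by simp
  then have "(\<lambda>n. mat_pow UNIV P n i j - p j) \<longlonglongrightarrow> 0"
    by (rule Lim_null_comparison[rotated]) (simp add: bound)
  then show ?thesis by (simp add: LIM_zero_iff)
qed

end

section \<open>Solutions of the Poisson equation\<close>

context stationary_chain
begin

text \<open>
  The function \<open>P\<^sup>n y\<close>, for signed \<open>y\<close>.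
\<close>
definition power_apply :: "nat \<Rightarrow> 'a vec \<Rightarrow> 'a vec" where
  "power_apply n y i = (\<integral>k. mat_pow UNIV P n i k * y k \<partial>count_space UNIV)"

lemma mat_pow_le_ratio: "mat_pow UNIV P n i k \<le> p k / p i"
  using invariant_dominates[of i n k] p_pos[of i] by (simp add: field_simps)

lemma dominated_by_invariant:
  assumes "integrable (count_space UNIV) (\<lambda>k. p k * y k)"
  shows "integrable (count_space UNIV) (\<lambda>k. p k / p i * \<bar>y k\<bar>)"
    and "norm (mat_pow UNIV P n i k * y k) \<le> p k / p i * \<bar>y k\<bar>"
proof -
  have "integrable (count_space UNIV) (\<lambda>k. norm (p k * y k) / p i)"
    using assms by (intro integrable_divide_zero integrable_norm)
  moreover have "norm (p k * y k) / p i = p k / p i * \<bar>y k\<bar>" for k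
    by (simp add: abs_mult p_nonneg)
  ultimately show "integrable (count_space UNIV) (\<lambda>k. p k / p i * \<bar>y k\<bar>)"
    by (simp only:)
  show "norm (mat_pow UNIV P n i k * y k) \<le> p k / p i * \<bar>y k\<bar>"
    using mult_right_mono[OF mat_pow_le_ratio[of n i k], of "\<bar>y k\<bar>"]
    by (simp add: abs_mult mat_pow_nonneg)
qed

lemma integrable_power_apply:
  assumes "integrable (count_space UNIV) (\<lambda>k. p k * y k)"
  shows "integrable (count_space UNIV) (\<lambda>k. mat_pow UNIV P n i k * y k)"
  by (rule Bochner_Integration.integrable_bound[OF dominated_by_invariant(1)[OF assms, of i]])
    (use dominated_by_invariant(2)[OF assms, of n i] in
      \<open>auto simp: AE_count_space abs_mult p_nonneg abs_of_pos[OF p_pos]\<close>)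

lemma power_apply_0: "power_apply 0 y i = y i"
proof -
  have "power_apply 0 y i = (\<integral>k. y i * indicator {i} k \<partial>count_space UNIV)"
    unfolding power_apply_def by (intro Bochner_Integration.integral_cong) (auto simp: ident_def indicator_def)
  then show ?thesis by simp
qed

lemma mat_pow_1: "mat_pow UNIV P (Suc 0) i k = P i k"
proof -
  have "ennreal (mat_pow UNIV P (Suc 0) i k) = taboo_step P {} (indicator {k}) i"
    unfolding ennreal_mat_pow by simp
  also have "\<dots> = ennreal (P i k)"
    by (simp add: taboo_step_def nn_integral_indicator_point)
  finally show ?thesis by (metis ennreal_inj P_nonneg mat_pow_nonneg)
qed

lemma nn_integral_mat_pow_Suc:
  "(\<integral>\<^sup>+x. ennreal (P i x * mat_pow UNIV P n x k) \<partial>count_space UNIV) =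
     ennreal (mat_pow UNIV P (Suc n) i k)"
  unfolding ennreal_mat_pow
  by (simp add: ennreal_mult' P_nonneg ennreal_mat_pow taboo_step_def[of _ _ _ i])

lemma power_apply_Suc:
  assumes y: "integrable (count_space UNIV) (\<lambda>k. p k * y k)"
  shows "integrable (count_space UNIV) (\<lambda>x. P i x * power_apply n y x)"
    and "power_apply (Suc n) y i = (\<integral>x. P i x * power_apply n y x \<partial>count_space UNIV)"
proof -
  let ?C = "count_space (UNIV :: 'a set)"
  let ?f = "\<lambda>x k. P i x * mat_pow UNIV P n x k * y k"
  interpret pair_sigma_finite ?C ?C
    by (intro pair_sigma_finite.intro sigma_finite_measure_count_space)
  have prod: "?C \<Otimes>\<^sub>M ?C = count_space UNIV"
    by (subst pair_measure_countable) auto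
  \<comment> \<open>Tonelli: summing over \<open>x\<close> first leaves the series of \<open>P\<^sup>n\<^sup>+\<^sup>1 \<bar>y\<bar>\<close>, which is finite.\<close>
  have col: "(\<integral>\<^sup>+x. ennreal (norm (?f x k)) \<partial>?C) = ennreal (norm (mat_pow UNIV P (Suc n) i k * y k))" for k
  proof -
    have "(\<integral>\<^sup>+x. ennreal (norm (?f x k)) \<partial>?C) =
        (\<integral>\<^sup>+x. ennreal (P i x * mat_pow UNIV P n x k) * ennreal \<bar>y k\<bar> \<partial>?C)"
      by (intro nn_integral_cong)
        (simp add: abs_mult P_nonneg mat_pow_nonneg ennreal_mult'')
    also have "\<dots> = ennreal (mat_pow UNIV P (Suc n) i k) * ennreal \<bar>y k\<bar>"
      by (subst nn_integral_multc) (simp_all only: nn_integral_mat_pow_Suc, simp)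
    finally show ?thesis
      by (simp add: abs_mult ennreal_mult'' abs_of_nonneg[OF mat_pow_nonneg] del: mat_pow.simps)
  qed
  have int: "integrable (?C \<Otimes>\<^sub>M ?C) (case_prod ?f)"
    unfolding prod
  proof (rule integrableI_bounded)
    have "(\<integral>\<^sup>+z. ennreal (norm (case_prod ?f z)) \<partial>count_space UNIV) =
        (\<integral>\<^sup>+k. \<integral>\<^sup>+x. ennreal (norm (?f x k)) \<partial>?C \<partial>?C)"
      by (subst nn_integral_snd_count_space[symmetric]) simp
    also have "\<dots> < \<infinity>"
      using integrable_power_apply[OF y, of "Suc n" i] unfolding col
      by (simp add: integrable_iff_bounded del: mat_pow.simps)
    finally show "(\<integral>\<^sup>+z. ennreal (norm (case_prod ?f z)) \<partial>count_space UNIV) < \<infinity>" .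
  qed simp
  have row: "(\<integral>k. ?f x k \<partial>?C) = P i x * power_apply n y x" for x
    by (simp add: power_apply_def mult.assoc)
  show "integrable ?C (\<lambda>x. P i x * power_apply n y x)"
    using integrable_fst[OF int] by (simp add: row)
  have "(\<integral>x. ?f x k \<partial>?C) = mat_pow UNIV P (Suc n) i k * y k" for k
  proof -
    have "(\<integral>x. P i x * mat_pow UNIV P n x k \<partial>?C) = mat_pow UNIV P (Suc n) i k"
      by (rule integral_eq_nn_integral[THEN trans])
        (simp_all only: nn_integral_mat_pow_Suc, simp_all add: P_nonneg mat_pow_nonneg enn2real_ennreal del: mat_pow.simps)
    then show ?thesis by (simp only: integral_mult_left_zero)
  qed
  then have "power_apply (Suc n) y i = (\<integral>k. \<integral>x. ?f x k \<partial>?C \<partial>?C)"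
    by (simp only: power_apply_def)
  also have "\<dots> = (\<integral>x. \<integral>k. ?f x k \<partial>?C \<partial>?C)"
    by (rule Fubini_integral[OF int])
  finally show "power_apply (Suc n) y i = (\<integral>x. P i x * power_apply n y x \<partial>?C)"
    by (simp add: row)
qed

lemma power_apply_tendsto:
  assumes "aperiodic_chain P"
    and y: "integrable (count_space UNIV) (\<lambda>k. p k * y k)"
  shows "(\<lambda>n. power_apply n y i) \<longlonglongrightarrow> (\<integral>k. p k * y k \<partial>count_space UNIV)"
  unfolding power_apply_def
proof (rule integral_dominated_convergence[OF _ _ dominated_by_invariant(1)[OF y]])
  show "AE k in count_space UNIV. (\<lambda>n. mat_pow UNIV P n i k * y k) \<longlonglongrightarrow> p k * y k"
    by (simp add: AE_count_space tendsto_mult_right mat_pow_tendsto[OF assms(1)])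
  show "AE k in count_space UNIV. norm (mat_pow UNIV P n i k * y k) \<le> p k / p i * \<bar>y k\<bar>" for n
    using dominated_by_invariant(2)[OF y] by (simp add: AE_count_space)
qed auto

text \<open>
  Here \<open>P\<^sup>N y = y - (c + P c + \<dots> + P\<^sup>N\<^sup>-\<^sup>1 c)\<close> by induction, and \<open>P\<^sup>N y\<close> converges to the mean of \<open>y\<close>.
\<close>
theorem poisson_solution_sums:
  assumes "aperiodic_chain P"
    and y: "integrable (count_space UNIV) (\<lambda>k. p k * y k)"
    and c: "integrable (count_space UNIV) (\<lambda>k. p k * c k)"
    and poisson: "\<And>x. y x = c x + (\<integral>k. P x k * y k \<partial>count_space UNIV)"
  shows "(\<lambda>n. power_apply n c i) sums (y i - (\<integral>k. p k * y k \<partial>count_space UNIV))"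
proof -
  have "power_apply N y x = y x - (\<Sum>n<N. power_apply n c x)" for N x
  proof (induction N arbitrary: x)
    case (Suc N)
    let ?C = "count_space (UNIV :: 'a set)"
    have Py: "integrable ?C (\<lambda>k. P x k * y k)"
      using integrable_power_apply[OF y, of "Suc 0" x] by (simp add: mat_pow_1 del: mat_pow.simps)
    have "power_apply (Suc N) y x = (\<integral>k. P x k * power_apply N y k \<partial>?C)"
      by (rule power_apply_Suc(2)[OF y])
    also have "\<dots> = (\<integral>k. P x k * y k - (\<Sum>n<N. P x k * power_apply n c k) \<partial>?C)"
      by (simp add: Suc algebra_simps sum_distrib_left)
    also have "\<dots> = (\<integral>k. P x k * y k \<partial>?C) - (\<Sum>n<N. power_apply (Suc n) c x)"
      using Py power_apply_Suc[OF c]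
      by (subst Bochner_Integration.integral_diff) (auto simp: Bochner_Integration.integral_sum)
    also have "\<dots> = y x - (\<Sum>n<Suc N. power_apply n c x)"
      by (simp add: poisson[of x] sum.lessThan_Suc_shift power_apply_0 del: sum.lessThan_Suc)
    finally show ?case .
  qed (simp add: power_apply_0)
  then have "(\<Sum>n<N. power_apply n c i) = y i - power_apply N y i" for N
    by (simp add: algebra_simps)
  moreover have "(\<lambda>N. y i - power_apply N y i) \<longlonglongrightarrow> y i - (\<integral>k. p k * y k \<partial>count_space UNIV)"
    by (intro tendsto_diff tendsto_const power_apply_tendsto assms(1) y)
  ultimately show ?thesis unfolding sums_def by simp
qed

text \<open>
  The Poisson equation with \<open>c = 0\<close>.
\<close>
corollary harmonic_constant:
  assumes "aperiodic_chain P"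
    and y: "integrable (count_space UNIV) (\<lambda>k. p k * y k)"
    and "\<And>x. y x = (\<integral>k. P x k * y k \<partial>count_space UNIV)"
  shows "y i = (\<integral>k. p k * y k \<partial>count_space UNIV)"
proof -
  have "(\<lambda>n. power_apply n (\<lambda>_. 0) i) sums (y i - (\<integral>k. p k * y k \<partial>count_space UNIV))"
    by (rule poisson_solution_sums[OF assms(1) y]) (simp_all add: assms(3)[symmetric])
  then have "(\<lambda>n::nat. 0 :: real) sums (y i - (\<integral>k. p k * y k \<partial>count_space UNIV))"
    by (simp add: power_apply_def)
  from sums_unique2[OF sums_zero this] show ?thesis by simp
qed

lemma integrable_p: "integrable (count_space UNIV) p"
proof (rule integrableI_nonneg)
  show "(\<integral>\<^sup>+x. ennreal (p x) \<partial>count_space UNIV) < \<infinity>"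
    using mean_const[of 1] by (simp add: mean_def)
qed (auto simp: p_nonneg)

text \<open>
  With this \<open>c\<close>, the series of \<open>poisson_solution_sums\<close> is the one that defines column \<open>j\<close> of the deviation matrix.
\<close>
lemma power_apply_deviation:
  "power_apply n (\<lambda>x. of_bool (x = j) - p j) i = deviation_term P p n i j"
proof -
  let ?C = "count_space (UNIV :: 'a set)"
  have one: "(\<integral>\<^sup>+k. ennreal (mat_pow UNIV P n i k) \<partial>?C) = 1"
  proof -
    have "taboo_step P {} (\<lambda>_. 1) = (\<lambda>_. 1)"
      by (intro ext taboo_step_one[OF stoch])
    then have "(taboo_step P {} ^^ n) (\<lambda>_. 1) = (\<lambda>_. 1)"
      by (induction n) simp_all
    then show ?thesis
      using taboo_power_kernel[of n P "{}" "\<lambda>_. 1" i] by (simp add: ennreal_mat_pow)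
  qed
  have int: "integrable ?C (mat_pow UNIV P n i)"
    by (rule integrableI_nonneg) (auto simp: mat_pow_nonneg one)
  have int1: "(\<integral>k. mat_pow UNIV P n i k \<partial>?C) = 1"
    by (subst integral_eq_nn_integral) (auto simp: mat_pow_nonneg one)
  have "power_apply n (\<lambda>x. of_bool (x = j) - p j) i =
      (\<integral>k. mat_pow UNIV P n i j * indicator {j} k - p j * mat_pow UNIV P n i k \<partial>?C)"
    unfolding power_apply_def
    by (intro Bochner_Integration.integral_cong) (auto simp: indicator_def algebra_simps)
  also have "\<dots> = mat_pow UNIV P n i j - p j"
    using int by (subst Bochner_Integration.integral_diff) (auto simp: int1 integrable_mult_indicator)
  finally show ?thesis
    by (simp add: deviation_term_def mat_diff_def outer_def ones_def)
qed

end

section \<open>Group inverses of finite matrices\<close>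

text \<open>
  Gaussian elimination of the unknown \<open>a\<close> by an equation \<open>i0\<close> in which it occurs; the reduced system
  has one equation and one unknown less and is injective again.
\<close>
lemma injective_square_system_solvable:
  fixes C :: "'i \<Rightarrow> 'j \<Rightarrow> real"
  assumes "finite J" "finite I" "card I = card J"
    and "\<And>v. (\<And>i. i \<in> I \<Longrightarrow> (\<Sum>j\<in>J. C i j * v j) = 0) \<Longrightarrow> \<forall>j\<in>J. v j = 0"
  shows "\<exists>v. \<forall>i\<in>I. (\<Sum>j\<in>J. C i j * v j) = q i"
  using assms
proof (induction J arbitrary: I C q rule: finite_induct)
  case empty
  then show ?case by simp
next
  case (insert a J)
  have "\<exists>i\<in>I. C i a \<noteq> 0"
  proof (rule ccontr)
    assume "\<not> (\<exists>i\<in>I. C i a \<noteq> 0)"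
    then have "(\<Sum>j\<in>insert a J. C i j * of_bool (j = a)) = 0" if "i \<in> I" for i
      using that insert.hyps by (auto simp: sum.neutral)
    then have "\<forall>j\<in>insert a J. (of_bool (j = a) :: real) = 0" by (rule insert.prems(3))
    then show False by simp
  qed
  then obtain i0 where i0: "i0 \<in> I" "C i0 a \<noteq> 0" by blast
  define r where "r i = C i a / C i0 a" for i
  define D where "D i j = C i j - r i * C i0 j" for i j
  \<comment> \<open>\<open>lift s v\<close> extends \<open>v\<close> by the value at \<open>a\<close> for which equation \<open>i0\<close> has right-hand side \<open>s\<close>.\<close>
  define lift where "lift s v = v(a := (s - (\<Sum>j\<in>J. C i0 j * v j)) / C i0 a)" for s v
  have lift: "(\<Sum>j\<in>insert a J. C i j * lift s v j) = r i * s + (\<Sum>j\<in>J. D i j * v j)" for i s v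
  proof -
    have "(\<Sum>j\<in>J. C i j * lift s v j) = (\<Sum>j\<in>J. C i j * v j)"
      using insert.hyps by (intro sum.cong) (auto simp: lift_def)
    then have "(\<Sum>j\<in>insert a J. C i j * lift s v j) =
        C i a * ((s - (\<Sum>j\<in>J. C i0 j * v j)) / C i0 a) + (\<Sum>j\<in>J. C i j * v j)"
      using insert.hyps by (simp add: lift_def)
    moreover have "(\<Sum>j\<in>J. D i j * v j) = (\<Sum>j\<in>J. C i j * v j) - r i * (\<Sum>j\<in>J. C i0 j * v j)"
      by (simp add: D_def left_diff_distrib sum_subtractf sum_distrib_left mult.assoc)
    ultimately show ?thesis by (simp add: r_def diff_divide_distrib right_diff_distrib)
  qed
  \<comment> \<open>Equation \<open>i0\<close> itself is eliminated to \<open>0 = 0\<close>.\<close>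
  have D0: "(\<Sum>j\<in>J. D i0 j * v j) = 0" for v
    using i0 by (simp add: D_def r_def)
  have "\<exists>v. \<forall>i\<in>I - {i0}. (\<Sum>j\<in>J. D i j * v j) = q i - r i * q i0"
  proof (rule insert.IH)
    show "card (I - {i0}) = card J" using insert.prems insert.hyps i0 by simp
    show "\<forall>j\<in>J. v j = 0" if v: "\<And>i. i \<in> I - {i0} \<Longrightarrow> (\<Sum>j\<in>J. D i j * v j) = 0" for v
    proof -
      have "\<forall>j\<in>insert a J. lift 0 v j = 0"
      proof (rule insert.prems(3))
        show "(\<Sum>j\<in>insert a J. C i j * lift 0 v j) = 0" if "i \<in> I" for i
          unfolding lift using that v D0 by (cases "i = i0") auto
      qed
      then show ?thesis using insert.hyps by (auto simp: lift_def split: if_splits)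
    qed
  qed (use insert.prems in simp)
  then obtain v where v: "\<forall>i\<in>I - {i0}. (\<Sum>j\<in>J. D i j * v j) = q i - r i * q i0" by blast
  have "(\<Sum>j\<in>insert a J. C i j * lift (q i0) v j) = q i" if "i \<in> I" for i
    unfolding lift using that v D0 i0 by (cases "i = i0") (auto simp: r_def)
  then show ?case by blast
qed

lemma sum_of_bool_left:
  fixes f :: "'a \<Rightarrow> real"
  assumes "finite A" "i \<in> A"
  shows "(\<Sum>k\<in>A. of_bool (i = k) * f k) = f i" "(\<Sum>k\<in>A. of_bool (k = i) * f k) = f i"
    "(\<Sum>k\<in>A. f k * of_bool (k = i)) = f i" "(\<Sum>k\<in>A. f k * of_bool (i = k)) = f i"
proof -
  have "(\<Sum>k\<in>A. of_bool (i = k) * f k) = (\<Sum>k\<in>A. if k = i then f k else 0)"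
    by (intro sum.cong) auto
  then show "(\<Sum>k\<in>A. of_bool (i = k) * f k) = f i" using assms by simp
  then show "(\<Sum>k\<in>A. of_bool (k = i) * f k) = f i" "(\<Sum>k\<in>A. f k * of_bool (k = i)) = f i"
    "(\<Sum>k\<in>A. f k * of_bool (i = k)) = f i"
    by (simp_all add: mult.commute eq_commute[of _ i])
qed

lemma sum_mult_assoc:
  fixes X :: "'a \<Rightarrow> 'a \<Rightarrow> real"
  shows "(\<Sum>k\<in>A. (\<Sum>l\<in>A. u l * X l k) * v k) = (\<Sum>l\<in>A. u l * (\<Sum>k\<in>A. X l k * v k))"
proof -
  have "(\<Sum>k\<in>A. (\<Sum>l\<in>A. u l * X l k) * v k) = (\<Sum>k\<in>A. \<Sum>l\<in>A. u l * (X l k * v k))"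
    by (simp add: sum_distrib_right mult.assoc)
  also have "\<dots> = (\<Sum>l\<in>A. \<Sum>k\<in>A. u l * (X l k * v k))" by (rule sum.swap)
  finally show ?thesis by (simp add: sum_distrib_left)
qed

lemma finite_injective_imp_inverse:
  fixes C :: "'a \<Rightarrow> 'a \<Rightarrow> real"
  assumes A: "finite A"
    and inj: "\<And>v. (\<And>i. i \<in> A \<Longrightarrow> (\<Sum>j\<in>A. C i j * v j) = 0) \<Longrightarrow> \<forall>j\<in>A. v j = 0"
  obtains Z where "\<And>i j. i \<in> A \<Longrightarrow> j \<in> A \<Longrightarrow> (\<Sum>k\<in>A. C i k * Z k j) = of_bool (i = j)"
    and "\<And>i j. i \<in> A \<Longrightarrow> j \<in> A \<Longrightarrow> (\<Sum>k\<in>A. Z i k * C k j) = of_bool (i = j)"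
proof -
  have "\<forall>j. \<exists>v. \<forall>i\<in>A. (\<Sum>k\<in>A. C i k * v k) = of_bool (i = j)"
  proof
    fix j
    show "\<exists>v. \<forall>i\<in>A. (\<Sum>k\<in>A. C i k * v k) = of_bool (i = j)"
      by (rule injective_square_system_solvable[OF A A refl inj])
  qed
  then have "\<exists>z. \<forall>j. \<forall>i\<in>A. (\<Sum>k\<in>A. C i k * z j k) = of_bool (i = j)" by (rule choice)
  then obtain z where z: "\<And>i j. i \<in> A \<Longrightarrow> (\<Sum>k\<in>A. C i k * z j k) = of_bool (i = j)"
    by blast
  have left: "(\<Sum>k\<in>A. z k i * C k j) = of_bool (i = j)" if ij: "i \<in> A" "j \<in> A" for i j
  proof -
    \<comment> \<open>\<open>C (Z C - I) = 0\<close>, so injectivity makes the right inverse a left inverse.\<close>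
    let ?v = "\<lambda>i. (\<Sum>k\<in>A. z k i * C k j) - of_bool (i = j)"
    have "(\<Sum>l\<in>A. C i l * ?v l) = 0" if i: "i \<in> A" for i
    proof -
      have "(\<Sum>l\<in>A. C i l * (\<Sum>k\<in>A. z k l * C k j)) = (\<Sum>k\<in>A. (\<Sum>l\<in>A. C i l * z k l) * C k j)"
        by (rule sum_mult_assoc[symmetric])
      also have "\<dots> = (\<Sum>k\<in>A. of_bool (i = k) * C k j)" using z i by simp
      also have "\<dots> = C i j" using A i by (simp only: sum_of_bool_left)
      finally show ?thesis
        using A ij by (simp add: right_diff_distrib sum_subtractf sum_of_bool_left)
    qed
    then have "\<forall>i\<in>A. ?v i = 0" by (rule inj)
    then show ?thesis using ij by simp
  qed
  show ?thesis by (rule that[of "\<lambda>k j. z j k"]) (use z left in auto)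
qed

text \<open>
  The usual argument shows \<open>W U = W V\<close> and then \<open>U = U W U = V W V = V\<close>. Products are cut off outside
  \<open>A \<times> A\<close> in the proof, which makes matrices on \<open>A\<close> a monoid of functions with associative
  multiplication.
\<close>
lemma group_inverse_unique:
  assumes A: "finite A"
    and U: "is_group_inverse A W U" "\<And>i j. i \<notin> A \<or> j \<notin> A \<Longrightarrow> U i j = 0"
    and V: "is_group_inverse A W V" "\<And>i j. i \<notin> A \<or> j \<notin> A \<Longrightarrow> V i j = 0"
  shows "U = V"
proof -
  define R where "R X = (\<lambda>i j. if i \<in> A \<and> j \<in> A then X i j else (0::real))" for X :: "'a mat"
  define M where "M X Y = R (mat_mult A X Y)" for X Y
  have mm: "mat_mult A X Y i j = (\<Sum>k\<in>A. X i k * Y k j)" for X Y :: "'a mat" and i j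
    using A by (simp add: mat_mult_def)
  have assoc: "M (M X Y) Z = M X (M Y Z)" for X Y Z
    unfolding M_def R_def mm by (auto simp: fun_eq_iff sum_mult_assoc cong: sum.cong)
  have RM: "R (mat_mult A (mat_mult A X Y) Z) = M (M (R X) (R Y)) (R Z)"
    "R (mat_mult A X Y) = M (R X) (R Y)" for X Y Z
    unfolding M_def R_def mm by (auto simp: fun_eq_iff cong: sum.cong)
  have grp: "M (M (R W) X) (R W) = R W" "M (M X (R W)) X = X" "M X (R W) = M (R W) X"
    if "is_group_inverse A W X" "\<And>i j. i \<notin> A \<or> j \<notin> A \<Longrightarrow> X i j = 0" for X
  proof -
    have X: "R X = X" using that(2) by (auto simp: R_def fun_eq_iff)
    have "R (mat_mult A (mat_mult A W X) W) = R W" "R (mat_mult A (mat_mult A X W) X) = R X"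
      "R (mat_mult A X W) = R (mat_mult A W X)"
      using that(1) by (auto simp: is_group_inverse_def R_def fun_eq_iff)
    then show "M (M (R W) X) (R W) = R W" "M (M X (R W)) X = X" "M X (R W) = M (R W) X"
      unfolding RM X by simp_all
  qed
  note u = grp[OF U] and v = grp[OF V]
  have "M (R W) U = M (R W) V"
  proof -
    have "M (R W) U = M (M (M (R W) V) (R W)) U" by (simp only: v(1))
    also have "\<dots> = M (M (R W) V) (M (R W) U)" by (simp only: assoc)
    also have "\<dots> = M (M V (R W)) (M U (R W))" by (simp only: u(3) v(3))
    also have "\<dots> = M V (M (M (R W) U) (R W))" by (simp only: assoc)
    also have "\<dots> = M (R W) V" by (simp only: u(1) v(3))
    finally show ?thesis .
  qed
  then have E: "M U (R W) = M V (R W)" "M (R W) U = M (R W) V" using u(3) v(3) by simp_all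
  have "U = M (M U (R W)) U" by (simp only: u(2))
  also have "\<dots> = M V (M (R W) U)" by (simp only: E(1) assoc)
  also have "\<dots> = M (M V (R W)) V" by (simp only: E(2) assoc)
  also have "\<dots> = V" by (rule v(2))
  finally show ?thesis .
qed

text \<open>
  The matrix \<open>C = W + e \<nu>\<close> is injective: \<open>C v = 0\<close> gives \<open>\<nu> v = 0\<close> on multiplying by \<open>\<nu>\<close>, hence \<open>W v = 0\<close>,
  so \<open>v\<close> is constant and therefore zero. As \<open>C e = e\<close> and \<open>\<nu> C = \<nu>\<close>, the matrix \<open>C\<^sup>-\<^sup>1 - e \<nu>\<close> has the
  product \<open>I - e \<nu>\<close> with \<open>W\<close> on both sides, which makes it the group inverse.
\<close>
lemma group_inverse_projection:
  fixes W :: "'a mat"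
  assumes A: "finite A"
    and \<nu>: "(\<Sum>i\<in>A. \<nu> i) = 1"
    and row: "\<And>i. i \<in> A \<Longrightarrow> (\<Sum>j\<in>A. W i j) = 0"
    and col: "\<And>j. j \<in> A \<Longrightarrow> (\<Sum>i\<in>A. \<nu> i * W i j) = 0"
    and kernel: "\<And>v. (\<And>i. i \<in> A \<Longrightarrow> (\<Sum>j\<in>A. W i j * v j) = 0) \<Longrightarrow> \<exists>c. \<forall>i\<in>A. v i = c"
    and ij: "i \<in> A" "j \<in> A"
  shows "(\<Sum>k\<in>A. W i k * group_inverse A W k j) = of_bool (i = j) - \<nu> j"
proof -
  define C where "C i j = W i j + \<nu> j" for i j
  have C: "(\<Sum>j\<in>A. C i j * v j) = (\<Sum>j\<in>A. W i j * v j) + (\<Sum>j\<in>A. \<nu> j * v j)" for i v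
    by (simp add: C_def distrib_right sum.distrib)
  have inj: "\<forall>j\<in>A. v j = 0" if v: "\<And>i. i \<in> A \<Longrightarrow> (\<Sum>j\<in>A. C i j * v j) = 0" for v
  proof -
    have "0 = (\<Sum>i\<in>A. \<nu> i * (\<Sum>j\<in>A. C i j * v j))" using v by simp
    also have "\<dots> = (\<Sum>i\<in>A. \<nu> i * (\<Sum>j\<in>A. W i j * v j)) + (\<Sum>i\<in>A. \<nu> i) * (\<Sum>j\<in>A. \<nu> j * v j)"
      by (simp add: C distrib_left sum.distrib sum_distrib_right)
    also have "(\<Sum>i\<in>A. \<nu> i * (\<Sum>j\<in>A. W i j * v j)) = (\<Sum>j\<in>A. (\<Sum>i\<in>A. \<nu> i * W i j) * v j)"
      by (rule sum_mult_assoc[symmetric])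
    also have "\<dots> = 0" using col by simp
    finally have \<nu>v: "(\<Sum>j\<in>A. \<nu> j * v j) = 0" using \<nu> by simp
    then have "(\<Sum>j\<in>A. W i j * v j) = 0" if "i \<in> A" for i using v[OF that] C by simp
    then obtain c where c: "\<forall>i\<in>A. v i = c" using kernel by blast
    then have "(\<Sum>j\<in>A. \<nu> j * v j) = (\<Sum>j\<in>A. \<nu> j) * c" by (simp add: sum_distrib_right)
    then show ?thesis using c \<nu> \<nu>v by simp
  qed
  obtain Z where CZ: "\<And>i j. i \<in> A \<Longrightarrow> j \<in> A \<Longrightarrow> (\<Sum>k\<in>A. C i k * Z k j) = of_bool (i = j)"
    and ZC: "\<And>i j. i \<in> A \<Longrightarrow> j \<in> A \<Longrightarrow> (\<Sum>k\<in>A. Z i k * C k j) = of_bool (i = j)"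
    using finite_injective_imp_inverse[OF A inj] by blast
  have Ce: "(\<Sum>j\<in>A. C i j) = 1" if "i \<in> A" for i
    using C[of i "\<lambda>_. 1"] row[OF that] \<nu> by simp
  have \<nu>C: "(\<Sum>i\<in>A. \<nu> i * C i j) = \<nu> j" if "j \<in> A" for j
    using col[OF that] \<nu> by (simp add: C_def distrib_left sum.distrib sum_distrib_right[symmetric])
  have Ze: "(\<Sum>j\<in>A. Z i j) = 1" if i: "i \<in> A" for i
  proof -
    have "(\<Sum>k\<in>A. Z i k * 1) = (\<Sum>k\<in>A. Z i k * (\<Sum>j\<in>A. C k j * 1))" using Ce by simp
    also have "\<dots> = (\<Sum>j\<in>A. (\<Sum>k\<in>A. Z i k * C k j) * 1)" by (rule sum_mult_assoc[symmetric])
    also have "\<dots> = (\<Sum>j\<in>A. of_bool (i = j) * 1)" using ZC[OF i] by simp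
    also have "\<dots> = 1" using A i by (simp only: sum_of_bool_left)
    finally show ?thesis by simp
  qed
  have \<nu>Z: "(\<Sum>i\<in>A. \<nu> i * Z i j) = \<nu> j" if j: "j \<in> A" for j
  proof -
    have "(\<Sum>i\<in>A. \<nu> i * Z i j) = (\<Sum>k\<in>A. (\<Sum>i\<in>A. \<nu> i * C i k) * Z k j)" using \<nu>C by simp
    also have "\<dots> = (\<Sum>i\<in>A. \<nu> i * (\<Sum>k\<in>A. C i k * Z k j))" by (rule sum_mult_assoc)
    also have "\<dots> = (\<Sum>i\<in>A. \<nu> i * of_bool (i = j))" using CZ j by simp
    also have "\<dots> = \<nu> j" using A j by (simp only: sum_of_bool_left)
    finally show ?thesis .
  qed
  define V where "V i j = (if i \<in> A \<and> j \<in> A then Z i j - \<nu> j else 0)" for i j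
  have WV: "(\<Sum>k\<in>A. W i k * V k j) = of_bool (i = j) - \<nu> j" if ij: "i \<in> A" "j \<in> A" for i j
  proof -
    have "(\<Sum>k\<in>A. W i k * V k j) = (\<Sum>k\<in>A. C i k * Z k j) - (\<Sum>k\<in>A. \<nu> k * Z k j) - (\<Sum>k\<in>A. W i k) * \<nu> j"
      using ij by (simp add: V_def C_def algebra_simps sum.distrib sum_subtractf sum_distrib_left)
    then show ?thesis using CZ \<nu>Z row ij by simp
  qed
  have VW: "(\<Sum>k\<in>A. V i k * W k j) = of_bool (i = j) - \<nu> j" if ij: "i \<in> A" "j \<in> A" for i j
  proof -
    have "(\<Sum>k\<in>A. V i k * W k j) = (\<Sum>k\<in>A. Z i k * C k j) - (\<Sum>k\<in>A. Z i k) * \<nu> j - (\<Sum>k\<in>A. \<nu> k * W k j)"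
      using ij by (simp add: V_def C_def algebra_simps sum.distrib sum_subtractf sum_distrib_left)
    then show ?thesis using ZC Ze col ij by simp
  qed
  have mm: "mat_mult A X Y i j = (\<Sum>k\<in>A. X i k * Y k j)" for X Y :: "'a mat" and i j
    using A by (simp add: mat_mult_def)
  have "is_group_inverse A W V"
    unfolding is_group_inverse_def
  proof (intro conjI ballI)
    fix i j assume ij: "i \<in> A" "j \<in> A"
    have "mat_mult A (mat_mult A W V) W i j = (\<Sum>k\<in>A. (of_bool (i = k) - \<nu> k) * W k j)"
      unfolding mm using ij WV by (auto intro!: sum.cong)
    also have "\<dots> = W i j"
      using A ij col by (simp add: left_diff_distrib sum_subtractf sum_of_bool_left)
    finally show "mat_mult A (mat_mult A W V) W i j = W i j" .
    have "mat_mult A (mat_mult A V W) V i j = (\<Sum>k\<in>A. (of_bool (i = k) - \<nu> k) * V k j)"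
      unfolding mm using ij VW by (auto intro!: sum.cong)
    also have "\<dots> = V i j - (\<Sum>k\<in>A. \<nu> k * V k j)"
      using A ij by (simp add: left_diff_distrib sum_subtractf sum_of_bool_left)
    also have "(\<Sum>k\<in>A. \<nu> k * V k j) = (\<Sum>k\<in>A. \<nu> k * Z k j) - (\<Sum>k\<in>A. \<nu> k) * \<nu> j"
      using ij by (simp add: V_def algebra_simps sum_subtractf sum_distrib_left)
    also have "\<dots> = 0" using \<nu>Z \<nu> ij by simp
    finally show "mat_mult A (mat_mult A V W) V i j = V i j" by simp
    show "mat_mult A V W i j = mat_mult A W V i j"
      unfolding mm using VW WV ij by simp
  qed
  moreover have "\<forall>i j. i \<notin> A \<or> j \<notin> A \<longrightarrow> V i j = 0" by (simp add: V_def)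
  ultimately have "group_inverse A W = V"
    unfolding group_inverse_def
    by (intro the_equality) (auto intro: group_inverse_unique[OF A])
  then show ?thesis using WV[OF ij] by simp
qed

section \<open>The matrix built from the censored chain\<close>

lemma mat_mult_finite:
  "finite A \<Longrightarrow> mat_mult A X Y i j = (\<Sum>k\<in>A. X i k * Y k j)"
  by (simp add: mat_mult_def)

locale integrable_hitting = stationary_chain P p for P :: "'a::countable mat" and p +
  fixes A :: "'a set"
  assumes finA: "finite A" and neA: "A \<noteq> {}"
    and aper: "aperiodic_chain P"
    and mean_hit: "mean p (potential P A (\<lambda>_. 1)) < \<infinity>"
begin

text \<open>
  The real-valued potential. For \<open>f\<close> between 0 and 1 it is bounded by the expected return time, so
  no infinite value is turned into 0.
\<close>
definition pot :: "('a \<Rightarrow> real) \<Rightarrow> 'a \<Rightarrow> real" where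
  "pot f x = enn2real (potential P A (\<lambda>k. ennreal (f k)) x)"

definition unit_fun :: "('a \<Rightarrow> real) \<Rightarrow> bool" where
  "unit_fun f \<longleftrightarrow> (\<forall>k. 0 \<le> f k \<and> f k \<le> 1)"

lemma P_le_1: "P x y \<le> 1"
proof -
  have "taboo_step P {} (indicator {y}) x \<le> 1"
    by (rule taboo_step_le_const[OF stoch]) (simp add: indicator_def)
  then show ?thesis by (simp add: taboo_step_def nn_integral_indicator_point)
qed

lemma unit_funs:
  "unit_fun (\<lambda>k. of_bool (k = j))" "unit_fun (\<lambda>_. 1)" "unit_fun (\<lambda>k. P k a)"
  by (auto simp: unit_fun_def P_nonneg P_le_1)

lemma potential_le_hitting: "unit_fun f \<Longrightarrow> potential P A (\<lambda>k. ennreal (f k)) x \<le> potential P A (\<lambda>_. 1) x"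
  by (rule potential_mono) (simp add: unit_fun_def)

lemma ennreal_pot:
  assumes "unit_fun f"
  shows "ennreal (pot f x) = potential P A (\<lambda>k. ennreal (f k)) x"
proof -
  have "potential P A (\<lambda>k. ennreal (f k)) x < \<infinity>"
    using potential_le_hitting[OF assms] expected_hitting_time_finite[OF neA] by (rule le_less_trans)
  then show ?thesis by (simp add: pot_def)
qed

lemma pot_nonneg: "0 \<le> pot f x"
  by (simp add: pot_def)

lemma pot_first_step:
  assumes f: "unit_fun f"
  shows "has_bochner_integral (count_space UNIV) (\<lambda>k. P x k * (pot f k * indicator (- A) k)) (pot f x - f x)"
proof (rule has_bochner_integral_nn_integral)
  have f0: "0 \<le> f x" using f by (simp add: unit_fun_def)
  have "ennreal (pot f x) = ennreal (f x) + taboo_step P A (potential P A (\<lambda>k. ennreal (f k))) x"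
    unfolding ennreal_pot[OF f] by (rule potential_unfold)
  also have "taboo_step P A (potential P A (\<lambda>k. ennreal (f k))) x =
      (\<integral>\<^sup>+k. ennreal (P x k * (pot f k * indicator (- A) k)) \<partial>count_space UNIV)" (is "_ = ?I")
    unfolding taboo_step_def ennreal_pot[OF f, symmetric]
    by (intro nn_integral_cong) (auto simp: indicator_def ennreal_mult' P_nonneg)
  finally have eq: "ennreal (pot f x) = ennreal (f x) + ?I" .
  then have le: "f x \<le> pot f x" using pot_nonneg[of f x]
    by (metis ennreal_le_iff le_iff_add)
  then show "0 \<le> pot f x - f x" by simp
  have "ennreal (f x) + ?I = ennreal (f x) + ennreal (pot f x - f x)"
    using f0 le by (simp add: eq[symmetric] ennreal_plus[symmetric] del: ennreal_plus)
  then show "?I = ennreal (pot f x - f x)"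
    by (simp add: ennreal_add_left_cancel)
qed (auto simp: P_nonneg pot_nonneg indicator_def)

lemma integrable_pot:
  assumes f: "unit_fun f"
  shows "integrable (count_space UNIV) (\<lambda>k. p k * pot f k)"
proof (rule integrableI_nonneg)
  have "(\<integral>\<^sup>+k. ennreal (p k * pot f k) \<partial>count_space UNIV) =
      mean p (potential P A (\<lambda>k. ennreal (f k)))"
    unfolding mean_def by (intro nn_integral_cong) (simp add: ennreal_mult' p_nonneg ennreal_pot[OF f])
  also have "\<dots> \<le> mean p (potential P A (\<lambda>_. 1))"
    by (rule mean_mono) (rule potential_le_hitting[OF f])
  also have "\<dots> < \<infinity>" by (rule mean_hit)
  finally show "(\<integral>\<^sup>+k. ennreal (p k * pot f k) \<partial>count_space UNIV) < \<infinity>" .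
qed (auto simp: p_nonneg pot_nonneg)

lemma kac_pot:
  assumes f: "unit_fun f" and "0 \<le> s" "mean p (\<lambda>k. ennreal (f k)) = ennreal s"
  shows "(\<Sum>a\<in>A. p a * pot f a) = s"
proof -
  have "mean p (potential P A (\<lambda>k. ennreal (f k))) < \<infinity>"
    by (rule le_less_trans[OF mean_mono mean_hit]) (rule potential_le_hitting[OF f])
  then have "ennreal s = mean p (\<lambda>x. potential P A (\<lambda>k. ennreal (f k)) x * indicator A x)"
    using kac assms(3) by simp
  also have "\<dots> = (\<integral>\<^sup>+x. ennreal (p x * pot f x) * indicator A x \<partial>count_space UNIV)"
    unfolding mean_def ennreal_pot[OF f, symmetric]
    by (intro nn_integral_cong) (simp add: ennreal_mult' p_nonneg mult.assoc)
  also have "\<dots> = (\<integral>\<^sup>+x. ennreal (p x * pot f x) \<partial>count_space A)"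
    by (rule nn_integral_count_space_indicator[symmetric]) simp
  also have "\<dots> = ennreal (\<Sum>a\<in>A. p a * pot f a)"
    by (simp add: nn_integral_count_space_finite[OF finA] sum_ennreal p_nonneg pot_nonneg)
  finally show ?thesis
    using assms(2) by (simp add: sum_nonneg p_nonneg pot_nonneg)
qed

definition visits :: "'a mat" where
  "visits x j = pot (\<lambda>k. of_bool (k = j)) x"

definition hit_time :: "'a vec" where
  "hit_time x = pot (\<lambda>_. 1) x"

definition hit_dist :: "'a mat" where
  "hit_dist x a = pot (\<lambda>k. P k a) x"

lemma ennreal_of_bool_indicator: "(\<lambda>k. ennreal (of_bool (k = j))) = indicator {j}"
  by (auto simp: indicator_def fun_eq_iff)

lemma kac_visits: "(\<Sum>a\<in>A. p a * visits a j) = p j"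
  unfolding visits_def
  by (rule kac_pot[OF unit_funs(1)]) (simp_all add: p_nonneg ennreal_of_bool_indicator mean_indicator)

lemma kac_hit_time: "(\<Sum>a\<in>A. p a * hit_time a) = 1"
  unfolding hit_time_def
  by (rule kac_pot[OF unit_funs(2)]) (simp_all add: mean_const)

lemma kac_hit_dist: "(\<Sum>b\<in>A. p b * hit_dist b a) = p a"
  unfolding hit_dist_def
proof (rule kac_pot[OF unit_funs(3)])
  have "(\<lambda>k. ennreal (P k a)) = taboo_step P {} (indicator {a})"
    by (auto simp: taboo_step_def nn_integral_indicator_point fun_eq_iff)
  then show "mean p (\<lambda>k. ennreal (P k a)) = ennreal (p a)"
    using mean_free_power[of "Suc 0" "indicator {a}"] by (simp add: mean_indicator)
qed (rule p_nonneg)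

text \<open>
  The chain returns to \<open>A\<close> almost surely. Apply the potential to \<open>1 = P(\<cdot>, A) + taboo_step P A 1\<close> and
  compare with \<open>potential_unfold'\<close>; the common term is finite and cancels.
\<close>
lemma hit_dist_sum: "(\<Sum>a\<in>A. hit_dist x a) = 1"
proof -
  let ?f = "\<lambda>k. \<Sum>a\<in>A. ennreal (P k a)"
  have split: "?f k + taboo_step P A (\<lambda>_. 1) k = 1" for k
  proof -
    have "?f k = (\<integral>\<^sup>+l. ennreal (P k l) * indicator A l \<partial>count_space UNIV)"
      by (simp add: nn_integral_count_space_indicator[symmetric] nn_integral_count_space_finite[OF finA])
    then have "?f k + taboo_step P A (\<lambda>_. 1) k =
        (\<integral>\<^sup>+l. ennreal (P k l) * indicator A l + ennreal (P k l) * (1 * indicator (- A) l) \<partial>count_space UNIV)"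
      unfolding taboo_step_def by (simp add: nn_integral_add)
    also have "\<dots> = taboo_step P {} (\<lambda>_. 1) k"
      unfolding taboo_step_def by (intro nn_integral_cong) (auto simp: indicator_def)
    finally show ?thesis by (simp add: taboo_step_one[OF stoch])
  qed
  have "1 + potential P A (taboo_step P A (\<lambda>_. 1)) x = potential P A (\<lambda>_. 1) x"
    by (rule potential_unfold'[symmetric])
  also have "\<dots> = potential P A (\<lambda>k. ?f k + taboo_step P A (\<lambda>_. 1) k) x"
    by (simp only: split)
  also have "\<dots> = potential P A ?f x + potential P A (taboo_step P A (\<lambda>_. 1)) x"
    by (rule potential_add)
  finally have "potential P A (taboo_step P A (\<lambda>_. 1)) x + 1 =
      potential P A (taboo_step P A (\<lambda>_. 1)) x + potential P A ?f x"
    by (simp add: add.commute)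
  moreover have "potential P A (taboo_step P A (\<lambda>_. 1)) x \<noteq> \<top>"
  proof -
    have "potential P A (taboo_step P A (\<lambda>_. 1)) x \<le> potential P A (\<lambda>_. 1) x"
      by (rule potential_mono) (rule taboo_step_le_const[OF stoch], simp)
    then show ?thesis using expected_hitting_time_finite[OF neA, of x] by (auto simp: top_unique)
  qed
  ultimately have "potential P A ?f x = 1" by (simp add: ennreal_add_left_cancel)
  then have "(\<Sum>a\<in>A. ennreal (hit_dist x a)) = 1"
    unfolding hit_dist_def ennreal_pot[OF unit_funs(3)] by (simp add: potential_sum[OF finA])
  then show ?thesis
    by (simp add: sum_ennreal hit_dist_def pot_nonneg)
qed

lemma P_hat_eq_visits: "P_hat P (- A) x j = visits x j"
proof -
  have eq: "ennreal (visits x j) = (\<Sum>n. ennreal (mat_pow (- A) P n x j))"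
    unfolding visits_def ennreal_pot[OF unit_funs(1)] ennreal_of_bool_indicator
    by (simp add: potential_def mat_pow_taboo(2)[OF stoch])
  have "summable (\<lambda>n. mat_pow (- A) P n x j)"
    by (rule summable_suminf_not_top) (simp_all add: mat_pow_taboo(1)[OF stoch] eq[symmetric])
  then have "ennreal (visits x j) = ennreal (P_hat P (- A) x j)"
    unfolding eq P_hat_def by (intro suminf_ennreal2 mat_pow_taboo(1)[OF stoch])
  moreover have "0 \<le> P_hat P (- A) x j"
    unfolding P_hat_def by (rule suminf_nonneg) (fact, rule mat_pow_taboo(1)[OF stoch])
  ultimately show ?thesis by (simp add: visits_def pot_nonneg)
qed

lemma visits_taboo: "j \<in> A \<Longrightarrow> visits x j = of_bool (x = j)"
  unfolding visits_def pot_def ennreal_of_bool_indicator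
  by (subst potential_taboo_supported) (auto simp: indicator_def)

text \<open>
  First-step analysis of the visits. Since \<open>visits x j = of_bool (x = j)\<close> for \<open>j \<in> A\<close>, it says that for rows in \<open>A\<close>
  the block matrix \<open>[I, P_{AB} H]\<close> is \<open>visits\<close>.
\<close>
lemma P_P_hat: "mat_mult (- A) P (P_hat P (- A)) x j = visits x j - of_bool (x = j)"
proof -
  have "((\<lambda>k. P x k * (visits k j * indicator (- A) k)) has_sum (visits x j - of_bool (x = j))) UNIV"
    using pot_first_step[OF unit_funs(1), of x j]
      integrable_has_sum[of "\<lambda>k. P x k * (visits k j * indicator (- A) k)"]
    by (simp add: has_bochner_integral_iff visits_def)
  then have "((\<lambda>k. P x k * visits k j) has_sum (visits x j - of_bool (x = j))) (- A)"
    by (rule has_sum_cong_neutral[THEN iffD1, rotated -1]) (auto simp: indicator_def)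
  then show ?thesis
    unfolding mat_mult_def P_hat_eq_visits by (rule infsumI)
qed

text \<open>
  Visits to \<open>A\<close> strictly before the return occur at time 0 only, which accounts for the term that
  the sum over the complement misses when \<open>x \<in> A\<close>.
\<close>
lemma infsum_visits:
  assumes f: "unit_fun f"
  shows "infsum (\<lambda>z. visits x z * f z) (- A) = pot f x - f x * of_bool (x \<in> A)"
proof -
  let ?g = "\<lambda>z. ennreal (f z)"
  have f0: "0 \<le> f z" for z using f by (simp add: unit_fun_def)
  have "potential P A ?g x = potential P A (\<lambda>z. ?g z * indicator A z + ?g z * indicator (- A) z) x"
    by (rule arg_cong[of _ _ "\<lambda>h. potential P A h x"]) (auto simp: indicator_def)
  also have "\<dots> = potential P A (\<lambda>z. ?g z * indicator A z) x + potential P A (\<lambda>z. ?g z * indicator (- A) z) x"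
    by (rule potential_add)
  also have "potential P A (\<lambda>z. ?g z * indicator A z) x = ennreal (f x * of_bool (x \<in> A))"
    by (subst potential_taboo_supported) (auto simp: indicator_def)
  also have "potential P A (\<lambda>z. ?g z * indicator (- A) z) x =
      (\<integral>\<^sup>+z. ennreal (visits x z * f z) * indicator (- A) z \<partial>count_space UNIV)" (is "_ = ?I")
    unfolding visits_def
    by (subst potential_kernel, intro nn_integral_cong)
      (simp add: ennreal_mult' pot_nonneg ennreal_pot[OF unit_funs(1)] ennreal_of_bool_indicator mult.assoc)
  finally have eq: "ennreal (pot f x) = ennreal (f x * of_bool (x \<in> A)) + ?I"
    unfolding ennreal_pot[OF f] .
  have "?I \<le> ennreal (pot f x)" unfolding eq by simp
  then have fin: "?I < \<infinity>" by (simp add: le_less_trans)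
  have nonneg: "0 \<le> visits x z * f z" for z by (simp add: visits_def pot_nonneg f0)
  have "ennreal (infsum (\<lambda>z. visits x z * f z) (- A)) = ?I"
    using fin nonneg by (intro infsum_nn_integral(2)) auto
  then have "ennreal (pot f x) = ennreal (f x * of_bool (x \<in> A) + infsum (\<lambda>z. visits x z * f z) (- A))"
    using eq nonneg f0 by (simp add: infsum_nonneg)
  then have "pot f x = f x * of_bool (x \<in> A) + infsum (\<lambda>z. visits x z * f z) (- A)"
    using nonneg f0 by (subst (asm) ennreal_inj) (auto simp: pot_nonneg infsum_nonneg)
  then show ?thesis by simp
qed

lemma censored_eq_hit_dist:
  assumes "i \<in> A"
  shows "censored P A i a = hit_dist i a"
proof -
  have "mat_mult (- A) (mat_mult (- A) P (P_hat P (- A))) P i a = infsum (\<lambda>k. visits i k * P k a) (- A)"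
    unfolding mat_mult_def[of "- A" "mat_mult (- A) P (P_hat P (- A))"] P_P_hat
    using assms by (intro infsum_cong) auto
  then show ?thesis
    using infsum_visits[OF unit_funs(3)] assms by (simp add: censored_def mat_add_def hit_dist_def)
qed

text \<open>
  The potential of the inhomogeneity \<open>of_bool (x = j) - p j\<close> of the Poisson equation.
\<close>
definition source :: "'a mat" where
  "source i j = visits i j - hit_time i * p j"

lemma X_tilde_A_eq:
  "X_tilde_A P p A i j = (\<Sum>k\<in>A. group_inverse A (mat_diff ident (censored P A)) i k * source k j)"
proof -
  let ?R = "mat_mult (- A) P (P_hat P (- A))"
  have "col_blocks A ident ?R k j = visits k j" if "k \<in> A" for k
    using that by (auto simp: col_blocks_def ident_def visits_taboo P_P_hat)
  moreover have "ones k + mat_vec (- A) ?R ones k = hit_time k" if "k \<in> A" for k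
  proof -
    have "mat_vec (- A) ?R ones k = infsum (\<lambda>z. visits k z * 1) (- A)"
      unfolding mat_vec_def P_P_hat using that by (intro infsum_cong) (auto simp: ones_def)
    then show ?thesis
      using infsum_visits[OF unit_funs(2)] that by (simp add: hit_time_def ones_def)
  qed
  ultimately show ?thesis
    by (auto simp: X_tilde_A_def Let_def mat_mult_finite[OF finA] mat_diff_def outer_def source_def
        intro!: sum.cong)
qed

lemma X_tilde_B_eq:
  assumes "i \<notin> A"
  shows "X_tilde_B P p A i j = (\<Sum>a\<in>A. hit_dist i a * X_tilde_A P p A a j) + source i j"
proof -
  let ?H = "P_hat P (- A)"
  have "mat_mult (- A) ?H P i a = hit_dist i a" for a
    using infsum_visits[OF unit_funs(3), of i a] assms by (simp add: mat_mult_def P_hat_eq_visits hit_dist_def)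
  moreover have "mat_vec (- A) ?H ones i = hit_time i"
    using infsum_visits[OF unit_funs(2), of i] assms
    by (simp add: mat_vec_def P_hat_eq_visits hit_time_def ones_def)
  moreover have "col_blocks A (\<lambda>_ _. 0) ?H i j = visits i j"
    using assms by (auto simp: col_blocks_def P_hat_eq_visits visits_taboo)
  ultimately show ?thesis
    by (simp add: X_tilde_B_def Let_def mat_diff_def mat_add_def outer_def source_def mat_mult_finite[OF finA])
qed

text \<open>
  A function that is given on \<open>A\<close> by \<open>u\<close> and elsewhere by the stopped expectation of \<open>u\<close> plus a
  potential solves the Poisson equation at every state, provided the same formula also reproduces \<open>u\<close> on \<open>A\<close>.
  Since \<open>pot_first_step\<close> covers states of \<open>A\<close> as well, no case distinction on \<open>x\<close> is needed.
\<close>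
lemma poisson_extension:
  fixes u y :: "'a \<Rightarrow> real"
  assumes y: "\<And>x. y x = (\<Sum>a\<in>A. hit_dist x a * u a) + (\<alpha> * visits x j + \<beta> * hit_time x)"
    and yA: "\<And>a. a \<in> A \<Longrightarrow> y a = u a"
  shows "integrable (count_space UNIV) (\<lambda>k. p k * y k)"
    and "y x = (\<alpha> * of_bool (x = j) + \<beta>) + (\<integral>k. P x k * y k \<partial>count_space UNIV)"
proof -
  have "integrable (count_space UNIV)
      (\<lambda>k. (\<Sum>a\<in>A. p k * hit_dist k a * u a) + (\<alpha> * (p k * visits k j) + \<beta> * (p k * hit_time k)))"
    unfolding hit_dist_def visits_def hit_time_def
    by (intro Bochner_Integration.integrable_add Bochner_Integration.integrable_sum
        integrable_mult_left integrable_mult_right integrable_pot unit_funs)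
  then show "integrable (count_space UNIV) (\<lambda>k. p k * y k)"
    by (simp add: y algebra_simps sum_distrib_left)
  note step = pot_first_step[OF unit_funs(1), of x j] pot_first_step[OF unit_funs(2), of x]
    pot_first_step[OF unit_funs(3), of x]
  have off: "has_bochner_integral (count_space UNIV)
      (\<lambda>k. (\<Sum>a\<in>A. (P x k * (hit_dist k a * indicator (- A) k)) * u a) +
        (\<alpha> * (P x k * (visits k j * indicator (- A) k)) + \<beta> * (P x k * (hit_time k * indicator (- A) k))))
      ((\<Sum>a\<in>A. (hit_dist x a - P x a) * u a) +
        (\<alpha> * (visits x j - of_bool (x = j)) + \<beta> * (hit_time x - 1)))"
    unfolding hit_dist_def visits_def hit_time_def
    by (intro has_bochner_integral_add has_bochner_integral_sum
        has_bochner_integral_mult_left has_bochner_integral_mult_right step)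
  \<comment> \<open>The part of \<open>P y\<close> coming from \<open>A\<close>, where \<open>y = u\<close>.\<close>
  have on: "has_bochner_integral (count_space UNIV)
      (\<lambda>k. \<Sum>a\<in>A. (P x a * u a) * indicator {a} k) (\<Sum>a\<in>A. (P x a * u a) * 1)"
  proof (intro has_bochner_integral_sum has_bochner_integral_mult_right)
    fix a show "has_bochner_integral (count_space UNIV) (indicator {a}) (1::real)"
      using has_bochner_integral_real_indicator[of "{a}" "count_space UNIV"] by simp
  qed
  have "(\<Sum>a\<in>A. (P x a * u a) * indicator {a} k) = P x k * y k * indicator A k" for k
  proof (cases "k \<in> A")
    case True
    have "(\<Sum>a\<in>A. (P x a * u a) * indicator {a} k) = (\<Sum>a\<in>A. (P x a * u a) * of_bool (a = k))"
      by (intro sum.cong) (auto simp: indicator_def)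
    then show ?thesis using True finA yA by (simp only: sum_of_bool_left) simp
  qed (auto simp: indicator_def intro!: sum.neutral)
  moreover have "(\<Sum>a\<in>A. (P x k * (hit_dist k a * indicator (- A) k)) * u a) +
        (\<alpha> * (P x k * (visits k j * indicator (- A) k)) + \<beta> * (P x k * (hit_time k * indicator (- A) k)))
      = P x k * y k * indicator (- A) k" for k
    by (simp add: y algebra_simps sum_distrib_left)
  ultimately have "has_bochner_integral (count_space UNIV)
      (\<lambda>k. P x k * y k * indicator (- A) k + P x k * y k * indicator A k)
      ((\<Sum>a\<in>A. (hit_dist x a - P x a) * u a) +
        (\<alpha> * (visits x j - of_bool (x = j)) + \<beta> * (hit_time x - 1)) + (\<Sum>a\<in>A. (P x a * u a) * 1))"
    using has_bochner_integral_add[OF off on] by (simp only:)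
  moreover have "P x k * y k * indicator (- A) k + P x k * y k * indicator A k = P x k * y k" for k
    by (simp add: indicator_def)
  ultimately have "(\<integral>k. P x k * y k \<partial>count_space UNIV) =
      (\<Sum>a\<in>A. (hit_dist x a - P x a) * u a) +
        (\<alpha> * (visits x j - of_bool (x = j)) + \<beta> * (hit_time x - 1)) + (\<Sum>a\<in>A. (P x a * u a) * 1)"
    by (simp only: has_bochner_integral_integral_eq)
  then show "y x = (\<alpha> * of_bool (x = j) + \<beta>) + (\<integral>k. P x k * y k \<partial>count_space UNIV)"
    by (simp add: y algebra_simps sum_subtractf)
qed

lemma censored_kernel:
  assumes "\<And>i. i \<in> A \<Longrightarrow> (\<Sum>a\<in>A. hit_dist i a * v a) = v i"
  shows "\<exists>c. \<forall>i\<in>A. v i = c"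
proof -
  \<comment> \<open>The zero coefficients make the state in \<open>visits\<close> immaterial; the equation then has \<open>c = 0\<close>.\<close>
  define y where "y x = (\<Sum>a\<in>A. hit_dist x a * v a) + (0 * visits x undefined + 0 * hit_time x)" for x
  have yA: "y a = v a" if "a \<in> A" for a using assms that by (simp add: y_def)
  have int: "integrable (count_space UNIV) (\<lambda>k. p k * y k)"
    by (rule poisson_extension(1)[OF y_def yA])
  have harm: "y x = (\<integral>k. P x k * y k \<partial>count_space UNIV)" for x
    using poisson_extension(2)[OF y_def yA, of x] by simp
  have "y i = (\<integral>k. p k * y k \<partial>count_space UNIV)" for i
    by (rule harmonic_constant[OF aper int]) (rule harm)
  then show ?thesis using yA by metis
qed

text \<open>
  For \<open>x \<notin> A\<close> this is the definition. For \<open>x \<in> A\<close> it amounts to \<open>W u = q\<close> with \<open>W = I - F\<close> and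
  \<open>u = V q\<close>, where \<open>V\<close> is the group inverse; as \<open>W V = I - e \<nu>\<close>, this holds because \<open>\<nu> q = 0\<close>.
\<close>
lemma X_tilde_extension:
  "X_tilde P p A x j = (\<Sum>a\<in>A. hit_dist x a * X_tilde_A P p A a j) + source x j"
proof (cases "x \<in> A")
  case False
  then show ?thesis by (simp add: X_tilde_def row_blocks_def X_tilde_B_eq)
next
  case x: True
  define mass where "mass = (\<Sum>a\<in>A. p a)"
  have mass: "0 < mass" unfolding mass_def by (rule sum_pos[OF finA neA]) (rule p_pos)
  define \<nu> where "\<nu> a = p a / mass" for a
  define W where "W = mat_diff ident (censored P A)"
  have Wv: "(\<Sum>a\<in>A. W i a * v a) = v i - (\<Sum>a\<in>A. hit_dist i a * v a)" if "i \<in> A" for i v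
  proof -
    have "(\<Sum>a\<in>A. W i a * v a) = (\<Sum>a\<in>A. of_bool (i = a) * v a) - (\<Sum>a\<in>A. hit_dist i a * v a)"
      using that by (simp add: W_def mat_diff_def ident_def censored_eq_hit_dist left_diff_distrib sum_subtractf)
    then show ?thesis using finA that by (simp only: sum_of_bool_left)
  qed
  have \<nu>W: "(\<Sum>i\<in>A. \<nu> i * W i a) = 0" if "a \<in> A" for a
  proof -
    have "(\<Sum>i\<in>A. \<nu> i * W i a) = (\<Sum>i\<in>A. \<nu> i * of_bool (i = a)) - (\<Sum>i\<in>A. p i * hit_dist i a) / mass"
      by (simp add: W_def mat_diff_def ident_def censored_eq_hit_dist right_diff_distrib sum_subtractf
          \<nu>_def sum_divide_distrib)
    also have "(\<Sum>i\<in>A. \<nu> i * of_bool (i = a)) = \<nu> a" using finA that by (simp only: sum_of_bool_left)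
    finally show ?thesis by (simp add: kac_hit_dist \<nu>_def)
  qed
  have proj: "(\<Sum>k\<in>A. W i k * group_inverse A W k l) = of_bool (i = l) - \<nu> l" if "i \<in> A" "l \<in> A" for i l
  proof (rule group_inverse_projection[OF finA _ _ \<nu>W _ that])
    show "(\<Sum>i\<in>A. \<nu> i) = 1"
      using mass by (simp add: \<nu>_def sum_divide_distrib[symmetric] mass_def[symmetric])
    show "(\<Sum>j\<in>A. W i j) = 0" if "i \<in> A" for i
      using Wv[OF that, of "\<lambda>_. 1"] by (simp add: hit_dist_sum)
    show "\<exists>c. \<forall>i\<in>A. v i = c" if "\<And>i. i \<in> A \<Longrightarrow> (\<Sum>j\<in>A. W i j * v j) = 0" for v
      by (rule censored_kernel) (use that Wv in force)
  qed
  have \<nu>q: "(\<Sum>l\<in>A. \<nu> l * source l j) = 0"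
  proof -
    have "(\<Sum>l\<in>A. \<nu> l * source l j) =
        ((\<Sum>l\<in>A. p l * visits l j) - (\<Sum>l\<in>A. p l * hit_time l) * p j) / mass"
      by (simp add: source_def \<nu>_def algebra_simps sum_subtractf sum_divide_distrib sum_distrib_left diff_divide_distrib)
    then show ?thesis by (simp add: kac_visits kac_hit_time)
  qed
  have "X_tilde_A P p A x j - (\<Sum>a\<in>A. hit_dist x a * X_tilde_A P p A a j) =
      (\<Sum>a\<in>A. W x a * (\<Sum>l\<in>A. group_inverse A W a l * source l j))"
    using Wv[OF x, of "\<lambda>a. X_tilde_A P p A a j"] by (simp add: X_tilde_A_eq W_def)
  also have "\<dots> = (\<Sum>l\<in>A. (\<Sum>a\<in>A. W x a * group_inverse A W a l) * source l j)"
    by (rule sum_mult_assoc[symmetric])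
  also have "\<dots> = (\<Sum>l\<in>A. of_bool (x = l) * source l j) - (\<Sum>l\<in>A. \<nu> l * source l j)"
    using proj x by (simp add: left_diff_distrib sum_subtractf)
  also have "\<dots> = source x j"
    using finA x \<nu>q by (simp add: sum_of_bool_left)
  finally show ?thesis using x by (simp add: X_tilde_def row_blocks_def)
qed

lemma X_tilde_poisson:
  shows "integrable (count_space UNIV) (\<lambda>k. p k * X_tilde P p A k j)"
    and "X_tilde P p A x j = (of_bool (x = j) - p j) + (\<integral>k. P x k * X_tilde P p A k j \<partial>count_space UNIV)"
proof -
  have y: "X_tilde P p A x j = (\<Sum>a\<in>A. hit_dist x a * X_tilde_A P p A a j) +
      (1 * visits x j + (- p j) * hit_time x)" for x
    by (simp add: X_tilde_extension source_def)
  have yA: "X_tilde P p A a j = X_tilde_A P p A a j" if "a \<in> A" for a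
    using that by (simp add: X_tilde_def row_blocks_def)
  show "integrable (count_space UNIV) (\<lambda>k. p k * X_tilde P p A k j)"
    by (rule poisson_extension(1)[OF y yA])
  show "X_tilde P p A x j = (of_bool (x = j) - p j) + (\<integral>k. P x k * X_tilde P p A k j \<partial>count_space UNIV)"
    using poisson_extension(2)[OF y yA, of x] by simp
qed

lemma deviation_sums:
  "(\<lambda>n. deviation_term P p n i j) sums
     (X_tilde P p A i j - (\<integral>k. p k * X_tilde P p A k j \<partial>count_space UNIV))"
proof -
  have "integrable (count_space UNIV) (\<lambda>k. p k * (of_bool (k = j) - p j))"
  proof (rule Bochner_Integration.integrable_bound[OF integrable_p])
    have "p j \<le> 1"
      using invariant_dominates[of j 0 j] mean_mono[of "indicator {j}" "\<lambda>_. 1" p]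
      by (simp add: mean_indicator mean_const indicator_def)
    then show "AE k in count_space UNIV. norm (p k * (of_bool (k = j) - p j)) \<le> norm (p k)"
      using p_nonneg[of j] by (auto simp: AE_count_space abs_mult p_nonneg intro!: mult_left_le)
  qed simp
  then show ?thesis
    using poisson_solution_sums[OF aper X_tilde_poisson(1) _ X_tilde_poisson(2), of j i]
    by (simp add: power_apply_deviation)
qed

lemma projection_has_sum:
  "((\<lambda>k. mat_diff ident (outer ones p) i k * X_tilde P p A k j) has_sum
     (X_tilde P p A i j - (\<integral>k. p k * X_tilde P p A k j \<partial>count_space UNIV))) UNIV"
proof -
  have mean: "((\<lambda>k. p k * X_tilde P p A k j) has_sum (\<integral>k. p k * X_tilde P p A k j \<partial>count_space UNIV)) UNIV"
    by (rule integrable_has_sum) (rule X_tilde_poisson(1))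
  have "((\<lambda>k. of_bool (i = k) * X_tilde P p A k j) has_sum X_tilde P p A i j) UNIV"
    by (rule has_sum_finite_neutralI[of "{i}"]) auto
  then have "((\<lambda>k. of_bool (i = k) * X_tilde P p A k j - p k * X_tilde P p A k j) has_sum
      (X_tilde P p A i j - (\<integral>k. p k * X_tilde P p A k j \<partial>count_space UNIV))) UNIV"
    using has_sum_add[OF _ has_sum_uminusI[OF mean]] by fastforce
  then show ?thesis
    by (simp add: mat_diff_def outer_def ones_def ident_def left_diff_distrib)
qed

end

theorem corollary3p1:
  fixes P :: "'a::countable \<Rightarrow> 'a \<Rightarrow> real" and p :: "'a \<Rightarrow> real" and A :: "'a set"
  assumes "stochastic P"
    and "irreducible_chain P"
    and "positive_recurrent_chain P"
    and "aperiodic_chain P"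
    and "invariant_prob P p"
    and "finite A" and "A \<noteq> {}"
    and "\<exists>i. expected_return_time P p i < \<infinity>"
  shows "(\<forall>i j. summable (\<lambda>n. deviation_term P p n i j)) \<and>
    (\<forall>i j. (\<lambda>k. mat_diff ident (outer ones p) i k * X_tilde P p A k j) summable_on UNIV) \<and>
    deviation P p = mat_mult UNIV (mat_diff ident (outer ones p)) (X_tilde P p A)"
proof -
  interpret stationary_chain P p
    by unfold_locales fact+
  obtain i where i: "expected_return_time P p i < \<infinity>" using assms(8) by blast
  have "mean p (potential P A (\<lambda>_. 1)) \<le>
      mean p (\<lambda>x. potential P {i} (\<lambda>_. 1) x + potential P A (\<lambda>_. 1) i)"
    by (rule mean_mono) (rule hitting_time_le)
  also have "\<dots> = mean p (potential P {i} (\<lambda>_. 1)) + potential P A (\<lambda>_. 1) i"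
    by (simp add: mean_add mean_const)
  also have "\<dots> < \<infinity>"
    using le_less_trans[OF mean_hitting_time_le_expected_return_time i]
      expected_hitting_time_finite[OF \<open>A \<noteq> {}\<close>, of i] by simp
  finally interpret integrable_hitting P p A
    by unfold_locales (use assms in auto)
  have "deviation P p i j = mat_mult UNIV (mat_diff ident (outer ones p)) (X_tilde P p A) i j" for i j
    unfolding deviation_def mat_mult_def
    using sums_unique[OF deviation_sums, of i j] infsumI[OF projection_has_sum, of i j] by simp
  then show ?thesis
    using sums_summable[OF deviation_sums] has_sum_imp_summable[OF projection_has_sum] by blast
qed

end
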